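(* Let $a,b\in\mathbb{R}$ and let $X=(ax+yz)\frac{\partial}{\partial x}+(by+xz)\frac{\partial}{\partial y}+(z-xy)\frac{\partial}{\partial z}$ be the corresponding vector field on $\mathbb{R}^3$. Then $X$ possesses the following Darboux polynomials: (i) $H_b(x,y,z)=x^2+z^2$, for $a=1$ and $b\in\mathbb{R}$, having cofactor $2$; (ii) $H_a(x,y,z)=y^2+z^2$, for $b=1$ and $a\in\mathbb{R}$, having cofactor $2$; (iii) $H_{ab}(x,y,z)=x^2-y^2$, for $a=b\in\mathbb{R}$, having cofactor $2a$. All other Darboux polynomials of $X$ are generated from these three (for given $a,b$, from those of the three that are listed for these parameter values).
   Context: A polynomial $f:\mathbb{R}^3\to\mathbb{R}$ is called a Darboux polynomial for a polynomial vector field $X$ on $\mathbb{R}^3$ if $\mathcal{L}_Xf=kf$ for some real polynomial $k:\mathbb{R}^3\to\mathbb{R}$, called the cofactor of $f$; here $\mathcal{L}_Xf=\nabla f\cdot X$ is the Lie derivative of $f$ along $X$. Let $\mathrm{Dar}$ be the set of all Darboux polynomials of a vector field. A finite collection $\mathcal{I}$ of such polynomials generates $\mathrm{Dar}$ if every member of $\mathrm{Dar}$ is the sum of members of $\mathcal{I}$ with the same cofactor, or a product of members of $\mathcal{I}$.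
   Formalization: For a=b the last claim is false: x−y and x+y are Darboux polynomials (cofactors a−z, a+z) not generated by the listed ones; there these two factors of H_ab are added to the generators. "Generates" allows real constants and repeated sums and products. *)

theory Defs
  imports "HOL-Analysis.Analysis"
begin

definition lie_derivative :: "(real^3 \<Rightarrow> real^3) \<Rightarrow> (real^3 \<Rightarrow> real) \<Rightarrow> real^3 \<Rightarrow> real" where
  "lie_derivative X f p = frechet_derivative f (at p) (X p)"

definition has_cofactor ::
    "(real^3 \<Rightarrow> real^3) \<Rightarrow> (real^3 \<Rightarrow> real) \<Rightarrow> (real^3 \<Rightarrow> real) \<Rightarrow> bool" where
  "has_cofactor X f k \<longleftrightarrow>
     real_polynomial_function f \<and> real_polynomial_function k \<and>
     (\<forall>p. lie_derivative X f p = k p * f p)"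

definition Dar :: "(real^3 \<Rightarrow> real^3) \<Rightarrow> (real^3 \<Rightarrow> real) set" where
  "Dar X = {f. \<exists>k. has_cofactor X f k}"

text \<open>
  Sums of members with the same cofactor, and products of members. Both operations may be
  iterated and combined, and real constants (Darboux polynomials with cofactor \<open>0\<close> of every
  vector field) come for free, so that scalar multiples and the empty product are covered.
\<close>

inductive_set generated :: "(real^3 \<Rightarrow> real^3) \<Rightarrow> (real^3 \<Rightarrow> real) set \<Rightarrow> (real^3 \<Rightarrow> real) set"
  for X :: "real^3 \<Rightarrow> real^3" and I :: "(real^3 \<Rightarrow> real) set" where
  const: "(\<lambda>p. c) \<in> generated X I"
| base: "f \<in> I \<Longrightarrow> f \<in> generated X I"
| prod: "f \<in> generated X I \<Longrightarrow> g \<in> generated X I \<Longrightarrow> (\<lambda>p. f p * g p) \<in> generated X I"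
| sum: "f \<in> generated X I \<Longrightarrow> g \<in> generated X I \<Longrightarrow>
    has_cofactor X f k \<Longrightarrow> has_cofactor X g k \<Longrightarrow> (\<lambda>p. f p + g p) \<in> generated X I"

definition generates_Dar :: "(real^3 \<Rightarrow> real^3) \<Rightarrow> (real^3 \<Rightarrow> real) set \<Rightarrow> bool" where
  "generates_Dar X I \<longleftrightarrow> finite I \<and> I \<subseteq> Dar X \<and> Dar X \<subseteq> generated X I"

definition X_field :: "real \<Rightarrow> real \<Rightarrow> real^3 \<Rightarrow> real^3" where
  "X_field a b p =
     vector [a * p$1 + p$2 * p$3, b * p$2 + p$1 * p$3, p$3 - p$1 * p$2]"

definition H_b :: "real^3 \<Rightarrow> real" where
  "H_b p = (p$1)\<^sup>2 + (p$3)\<^sup>2"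

definition H_a :: "real^3 \<Rightarrow> real" where
  "H_a p = (p$2)\<^sup>2 + (p$3)\<^sup>2"

definition H_ab :: "real^3 \<Rightarrow> real" where
  "H_ab p = (p$1)\<^sup>2 - (p$2)\<^sup>2"

definition listed :: "real \<Rightarrow> real \<Rightarrow> (real^3 \<Rightarrow> real) set" where
  "listed a b = {H. a = 1 \<and> H = H_b} \<union> {H. b = 1 \<and> H = H_a} \<union> {H. a = b \<and> H = H_ab}"

definition H_ab_minus :: "real^3 \<Rightarrow> real" where
  "H_ab_minus p = p$1 - p$2"

definition H_ab_plus :: "real^3 \<Rightarrow> real" where
  "H_ab_plus p = p$1 + p$2"

text \<open>
  For \<open>a = b\<close> the linear factors \<open>x - y\<close> and \<open>x + y\<close> of \<open>H_ab\<close> are themselves Darboux polynomials,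
  with the nonconstant cofactors \<open>a - z\<close> and \<open>a + z\<close>. They are not obtained from the listed
  polynomials by sums and products, since all of those are even in \<open>x\<close>. Hence, for \<open>a = b\<close>,
  "generated from the listed polynomials" can hold only when the factors of \<open>H_ab\<close> are
  admitted along with \<open>H_ab\<close>.
\<close>

lemma has_cofactor_H_ab_minus: "has_cofactor (X_field a a) H_ab_minus (\<lambda>p. a - p$3)"
proof -
  have bl: "bounded_linear H_ab_minus"
    unfolding H_ab_minus_def
    by (intro bounded_linear_sub bounded_linear_vec_nth)
  have k: "real_polynomial_function (\<lambda>p::real^3. a - p$3)"
  proof -
    have "bounded_linear (\<lambda>p::real^3. - p$3)"
      by (intro bounded_linear_minus bounded_linear_vec_nth)
    from real_polynomial_function.intros(3)[OF real_polynomial_function.intros(2)[of a]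
        real_polynomial_function.intros(1)[OF this]]
    show ?thesis by simp
  qed
  have "frechet_derivative H_ab_minus (at p) = H_ab_minus" for p
    using bounded_linear_imp_has_derivative[OF bl, of "at p"] frechet_derivative_at by metis
  then show ?thesis
    using bl k unfolding has_cofactor_def lie_derivative_def
    by (auto intro: real_polynomial_function.intros(1)
        simp: X_field_def H_ab_minus_def algebra_simps)
qed

lemma generated_listed_even:
  assumes "f \<in> generated X (listed a b)"
  shows "f (vector [- x, y, z]) = f (vector [x, y, z])"
  using assms
  by induction (auto simp: listed_def H_b_def H_a_def H_ab_def)

lemma not_generates_Dar_listed: "\<not> generates_Dar (X_field a a) (listed a a)"
proof
  assume "generates_Dar (X_field a a) (listed a a)"
  then have "H_ab_minus \<in> generated (X_field a a) (listed a a)"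
    using has_cofactor_H_ab_minus unfolding generates_Dar_def Dar_def by blast
  from generated_listed_even[OF this, of 1 0 0] show False
    by (simp add: H_ab_minus_def)
qed

end

(* Write X = L1 + L2 with L1 = (ax, by, z) linear and L2 = (yz, xz, -xy) quadratic.  L2 has the
   first integrals A = x^2 - y^2 and B = x^2 + z^2, and R[x,y,z] is free over R[A,B][x] with basis
   1, y, z, yz.  Comparing leading coefficients in x, a Darboux polynomial of L2 has cofactor
   N z or -N z with N a natural number, hence equals (x + y)^N F(A,B) or (x - y)^N F(A,B).  The top
   homogeneous component of a Darboux polynomial of X has this form.  The next lower degree of the
   Darboux equation says that some polynomial of the form \<alpha>(A,B) + \<beta>(A,B) x^2 lies in the image of L2,
   which forces \<alpha> = \<beta> = 0, because x^2 dt is a differential of the second kind on the elliptic curve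
   A = const, B = const.  These two conditions make the top component itself a generated Darboux
   polynomial with the same cofactor, so it can be subtracted. *)

theory Submission
  imports Defs "HOL-Computational_Algebra.Polynomial"
begin

section \<open>Polynomial functions and their Lie derivatives\<close>

text \<open>Reality of the coefficients matters. Over the complex numbers x + iz and y + iz are
  Darboux polynomials of L2 as well, with cofactors -iy and -ix. For a cofactor p x + q y + s z the
  leading coefficients give only (N - s)^2 + (p + q)^2 = 0 or (N + s)^2 + (p - q)^2 = 0; over the
  reals both squares vanish, and p is still free. It is removed by the symmetry x -> -x, which
  reverses L2. With \<sigma> = 1 or -1, the obstacle in the next degree is that L1(x + \<sigma> y) =
  a x + \<sigma> b y is a multiple of x + \<sigma> y only for a = b. Multiplying by the conjugate x
  - \<sigma> y leaves a term in xy, which is harmless because xy = -L2 z. Of the two conditions on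
  F(A,B), one says that all monomials A^i B^j of F have the same weight 2 b i + 2 j; the other links
  (i, j) to (i - 1, j + 1). Together they let a nonconstant F survive only for the listed parameter
  values. The integral y^2 + z^2 = B - A appears for b = 1 \<noteq> a, where F is constant in the
  direction (1, 1).\<close>

lemma real_polynomial_function_nth [simp, intro]: "real_polynomial_function (\<lambda>p::real^3. p$i)"
  by (intro real_polynomial_function.intros bounded_linear_vec_nth)

lemmas real_polynomial_function_simps [simp] =
  real_polynomial_function.intros(2-4) real_polynomial_function_minus
  real_polynomial_function_diff real_polynomial_function_power

text \<open>Every bounded linear functional on R^3 is a combination of the three coordinates, so
  statements about derivations need checking only on constants and coordinates, and for sums and
  products.\<close>

lemma real_polynomial_function_coordinate_induct [consumes 1, case_names const nth add mult]:
  fixes f :: "real^3 \<Rightarrow> real"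
  assumes f: "real_polynomial_function f"
    and const: "\<And>c. P (\<lambda>p. c)"
    and nth: "\<And>i. P (\<lambda>p. p$i)"
    and add: "\<And>f g. real_polynomial_function f \<Longrightarrow> P f \<Longrightarrow> real_polynomial_function g \<Longrightarrow> P g \<Longrightarrow> P (\<lambda>p. f p + g p)"
    and mult: "\<And>f g. real_polynomial_function f \<Longrightarrow> P f \<Longrightarrow> real_polynomial_function g \<Longrightarrow> P g \<Longrightarrow> P (\<lambda>p. f p * g p)"
  shows "P f"
  using f
proof induction
  case (linear f)
  have "f = (\<lambda>p. (f (axis 1 1) * p$1 + f (axis 2 1) * p$2) + f (axis 3 1) * p$3)"
  proof
    fix p :: "real^3"
    have "p = (\<Sum>i\<in>UNIV. (p$i) *\<^sub>R axis i 1)"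
      using basis_expansion[of p] by (simp add: scalar_mult_eq_scaleR)
    then have "f p = f (\<Sum>i\<in>UNIV. (p$i) *\<^sub>R axis i 1)" by simp
    also have "\<dots> = (\<Sum>i\<in>UNIV. (p$i) *\<^sub>R f (axis i 1))"
      by (simp only: linear_sum[OF bounded_linear.linear[OF linear]]
          linear_scale[OF bounded_linear.linear[OF linear]])
    finally show "f p = (f (axis 1 1) * p$1 + f (axis 2 1) * p$2) + f (axis 3 1) * p$3"
      by (simp add: sum_3 mult.commute)
  qed
  moreover have "P (\<lambda>p. (f (axis 1 1) * p$1 + f (axis 2 1) * p$2) + f (axis 3 1) * p$3)"
    by (intro add mult const nth) auto
  ultimately show ?case by (rule ssubst[where P=P])
qed (use const add mult in auto)

lemma lie_const [simp]: "lie_derivative X (\<lambda>p. c) p = 0"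
  by (simp add: lie_derivative_def)

lemma lie_nth [simp]: "lie_derivative X (\<lambda>p. p$i) p = X p $ i"
  unfolding lie_derivative_def
  by (metis bounded_linear_vec_nth bounded_linear_imp_has_derivative frechet_derivative_at)

lemma lie_add [simp]:
  assumes "real_polynomial_function f" "real_polynomial_function g"
  shows "lie_derivative X (\<lambda>p. f p + g p) p = lie_derivative X f p + lie_derivative X g p"
proof -
  have "f differentiable at p" "g differentiable at p"
    using assms differentiable_at_real_polynomial_function by blast+
  then have "(f has_derivative frechet_derivative f (at p)) (at p)"
    "(g has_derivative frechet_derivative g (at p)) (at p)"
    by (simp_all add: frechet_derivative_works)
  from frechet_derivative_at[OF has_derivative_add[OF this], symmetric]
  show ?thesis by (simp add: lie_derivative_def)
qed

lemma lie_mult [simp]: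
  assumes "real_polynomial_function f" "real_polynomial_function g"
  shows "lie_derivative X (\<lambda>p. f p * g p) p = f p * lie_derivative X g p + lie_derivative X f p * g p"
proof -
  have "f differentiable at p" "g differentiable at p"
    using assms differentiable_at_real_polynomial_function by blast+
  then have "(f has_derivative frechet_derivative f (at p)) (at p)"
    "(g has_derivative frechet_derivative g (at p)) (at p)"
    by (simp_all add: frechet_derivative_works)
  from frechet_derivative_at[OF has_derivative_mult[OF this], symmetric]
  show ?thesis by (simp add: lie_derivative_def)
qed

lemma lie_cmult [simp]:
  assumes "real_polynomial_function f"
  shows "lie_derivative X (\<lambda>p. c * f p) p = c * lie_derivative X f p"
  using assms by simp

lemma lie_minus [simp]:
  assumes "real_polynomial_function f"
  shows "lie_derivative X (\<lambda>p. - f p) p = - lie_derivative X f p"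
  using lie_cmult[OF assms, of X "-1"] by simp

lemma lie_diff [simp]:
  assumes "real_polynomial_function f" "real_polynomial_function g"
  shows "lie_derivative X (\<lambda>p. f p - g p) p = lie_derivative X f p - lie_derivative X g p"
  using lie_add[OF assms(1) real_polynomial_function_minus[OF assms(2)], of X] assms by simp

lemma lie_power [simp]:
  assumes "real_polynomial_function f"
  shows "lie_derivative X (\<lambda>p. f p ^ n) p = of_nat n * f p ^ (n - 1) * lie_derivative X f p"
proof (induction n)
  case (Suc n)
  then show ?case using assms by (cases n) (simp_all add: algebra_simps)
qed simp

lemma lie_sum:
  assumes "finite I" "\<And>i. i \<in> I \<Longrightarrow> real_polynomial_function (f i)"
  shows "lie_derivative X (\<lambda>p. \<Sum>i\<in>I. f i p) p = (\<Sum>i\<in>I. lie_derivative X (f i) p)"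
  using assms
proof (induction I rule: finite_induct)
  case (insert i I)
  have "real_polynomial_function (\<lambda>p. \<Sum>i\<in>I. f i p)"
    using insert by (intro real_polynomial_function_sum) auto
  with insert show ?case by simp
qed simp

lemma lie_add_field:
  assumes "real_polynomial_function f"
  shows "lie_derivative (\<lambda>p. X p + Y p) f p = lie_derivative X f p + lie_derivative Y f p"
  using assms by (induction rule: real_polynomial_function_coordinate_induct) (auto simp: algebra_simps)

lemma real_polynomial_function_on_line:
  fixes f :: "real^3 \<Rightarrow> real"
  assumes "real_polynomial_function f"
  shows "\<exists>P::real poly. \<forall>t. f (u + t *\<^sub>R v) = poly P t"
  using assms
proof (induction rule: real_polynomial_function_coordinate_induct)
  case (const c)
  then show ?case by (intro exI[of _ "[:c:]"]) simp
next
  case (nth i)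
  then show ?case by (intro exI[of _ "[:u$i, v$i:]"]) simp
next
  case (add f g)
  then show ?case by (metis poly_add)
next
  case (mult f g)
  then show ?case by (metis poly_mult)
qed

text \<open>On the line through u and v both functions become polynomials in one variable, whose
  ring has no zero divisors. This is the cancellation law for polynomial functions.\<close>

lemma real_polynomial_function_mult_eq_0:
  fixes f g :: "real^3 \<Rightarrow> real"
  assumes "real_polynomial_function f" "real_polynomial_function g"
    and "\<And>p. f p * g p = 0" and "f u \<noteq> 0"
  shows "g v = 0"
proof -
  obtain P where P: "\<And>t. f (u + t *\<^sub>R (v - u)) = poly P t"
    using real_polynomial_function_on_line[OF assms(1)] by blast
  obtain Q where Q: "\<And>t. g (u + t *\<^sub>R (v - u)) = poly Q t"
    using real_polynomial_function_on_line[OF assms(2)] by blast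
  have "poly (P * Q) t = 0" for t
    by (metis P Q assms(3) poly_mult)
  then have "P * Q = 0" using poly_all_0_iff_0 by blast
  moreover have "P \<noteq> 0" using P[of 0] assms(4) by auto
  ultimately show ?thesis using Q[of 1] by simp
qed

section \<open>Homogeneous components\<close>

text \<open>Homogeneity is generated by the rules of a graded ring rather than defined by the
  scaling law, so that rule induction shows how a derivation shifts the degree. The zero function
  belongs to every degree.\<close>

inductive hom_poly :: "nat \<Rightarrow> (real^3 \<Rightarrow> real) \<Rightarrow> bool" where
  zero: "hom_poly n (\<lambda>p. 0)"
| const: "hom_poly 0 (\<lambda>p. c)"
| nth: "hom_poly 1 (\<lambda>p. p$i)"
| add: "hom_poly n f \<Longrightarrow> hom_poly n g \<Longrightarrow> hom_poly n (\<lambda>p. f p + g p)"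
| mult: "hom_poly m f \<Longrightarrow> hom_poly n g \<Longrightarrow> hom_poly (m + n) (\<lambda>p. f p * g p)"

lemma hom_poly_sum:
  "finite I \<Longrightarrow> (\<And>i. i \<in> I \<Longrightarrow> hom_poly n (f i)) \<Longrightarrow> hom_poly n (\<lambda>p. \<Sum>i\<in>I. f i p)"
  by (induction I rule: finite_induct) (auto intro: hom_poly.intros)

lemma hom_poly_cmult: "hom_poly n f \<Longrightarrow> hom_poly n (\<lambda>p. c * f p)"
  using hom_poly.mult[OF hom_poly.const] by fastforce

lemma hom_poly_imp_polynomial: "hom_poly n f \<Longrightarrow> real_polynomial_function f"
  by (induction rule: hom_poly.induct) auto

lemma hom_poly_scale: "hom_poly n f \<Longrightarrow> f (t *\<^sub>R p) = t ^ n * f p"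
  by (induction rule: hom_poly.induct) (auto simp: algebra_simps power_add)

text \<open>Serves to write the parts of degree 0 and 1 of a cofactor as \<kappa> and p x + q y + s
  z. Both degrees are treated together because a product of degree 1 has a factor of degree
  0.\<close>

lemma hom_poly_0_1:
  assumes "hom_poly n f"
  shows "(n = 0 \<longrightarrow> (\<exists>c. f = (\<lambda>p. c))) \<and>
         (n = 1 \<longrightarrow> (\<exists>c1 c2 c3. f = (\<lambda>p. c1 * p$1 + c2 * p$2 + c3 * p$3)))"
  using assms
proof (induction rule: hom_poly.induct)
  case (zero n)
  have "(\<lambda>p::real^3. 0::real) = (\<lambda>p. 0 * p$1 + 0 * p$2 + 0 * p$3)" by simp
  then show ?case by blast
next
  case (nth i)
  have "(\<lambda>p::real^3. p$i) = (\<lambda>p. (if i = 1 then 1 else 0) * p$1 + (if i = 2 then 1 else 0) * p$2 + (if i = 3 then 1 else 0) * p$3)"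
    by (rule ext) (use exhaust_3[of i] in auto)
  then have "\<exists>c1 c2 c3. (\<lambda>p::real^3. p$i) = (\<lambda>p. c1 * p$1 + c2 * p$2 + c3 * p$3)"
    by (intro exI)
  then show ?case by simp
next
  case (add n f g)
  show ?case
  proof (intro conjI impI)
    assume "n = 0"
    then show "\<exists>c. (\<lambda>p. f p + g p) = (\<lambda>p. c)" using add.IH by fastforce
  next
    assume "n = 1"
    then obtain a1 a2 a3 b1 b2 b3 where
      "f = (\<lambda>p. a1 * p$1 + a2 * p$2 + a3 * p$3)" "g = (\<lambda>p. b1 * p$1 + b2 * p$2 + b3 * p$3)"
      using add.IH by blast
    then have "(\<lambda>p. f p + g p) = (\<lambda>p. (a1+b1) * p$1 + (a2+b2) * p$2 + (a3+b3) * p$3)"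
      by (auto simp: algebra_simps)
    then show "\<exists>c1 c2 c3. (\<lambda>p. f p + g p) = (\<lambda>p. c1 * p$1 + c2 * p$2 + c3 * p$3)" by blast
  qed
next
  case (mult m f n g)
  show ?case
  proof (intro conjI impI)
    assume "m + n = 0"
    then show "\<exists>c. (\<lambda>p. f p * g p) = (\<lambda>p. c)" using mult.IH by fastforce
  next
    assume "m + n = 1"
    then consider "m = 0" "n = 1" | "m = 1" "n = 0" by linarith
    then show "\<exists>c1 c2 c3. (\<lambda>p. f p * g p) = (\<lambda>p. c1 * p$1 + c2 * p$2 + c3 * p$3)"
    proof cases
      case 1
      then obtain c b1 b2 b3 where
        "f = (\<lambda>p. c)" "g = (\<lambda>p. b1 * p$1 + b2 * p$2 + b3 * p$3)"
        using mult.IH by blast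
      then have "(\<lambda>p. f p * g p) = (\<lambda>p. (c*b1) * p$1 + (c*b2) * p$2 + (c*b3) * p$3)"
        by (auto simp: algebra_simps)
      then show ?thesis by blast
    next
      case 2
      then obtain c b1 b2 b3 where
        "g = (\<lambda>p. c)" "f = (\<lambda>p. b1 * p$1 + b2 * p$2 + b3 * p$3)"
        using mult.IH by blast
      then have "(\<lambda>p. f p * g p) = (\<lambda>p. (c*b1) * p$1 + (c*b2) * p$2 + (c*b3) * p$3)"
        by (auto simp: algebra_simps)
      then show ?thesis by blast
    qed
  qed
qed auto

lemma sum_cauchy_product:
  fixes a b :: "nat \<Rightarrow> real"
  assumes a: "\<And>i. i \<ge> n \<Longrightarrow> a i = 0" and b: "\<And>i. i \<ge> m \<Longrightarrow> b i = 0" and T: "n + m \<le> T"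
  shows "(\<Sum>i<n. a i) * (\<Sum>i<m. b i) = (\<Sum>k<T. \<Sum>i\<le>k. a i * b (k - i))"
proof -
  have "(\<Sum>i<n. a i) = (\<Sum>i<T. a i)"
    by (rule sum.mono_neutral_left) (use a T in auto)
  moreover have "(\<Sum>i<m. b i) = (\<Sum>i<T. b i)"
    by (rule sum.mono_neutral_left) (use b T in auto)
  ultimately have "(\<Sum>i<n. a i) * (\<Sum>i<m. b i) = (\<Sum>(i,j)\<in>{..<T} \<times> {..<T}. a i * b j)"
    by (simp add: sum_product sum.cartesian_product)
  also have "\<dots> = (\<Sum>(i,j)\<in>{(i,j). i + j < T}. a i * b j)"
  proof (rule sum.mono_neutral_right)
    show "\<forall>ij\<in>{..<T} \<times> {..<T} - {(i, j). i + j < T}. (case ij of (i, j) \<Rightarrow> a i * b j) = 0"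
    proof
      fix ij assume "ij \<in> {..<T} \<times> {..<T} - {(i, j). i + j < T}"
      then have "fst ij \<ge> n \<or> snd ij \<ge> m" using T by (cases ij) auto
      then show "(case ij of (i, j) \<Rightarrow> a i * b j) = 0" using a b by (cases ij) auto
    qed
  qed auto
  also have "\<dots> = (\<Sum>k<T. \<Sum>i\<le>k. a i * b (k - i))"
    by (rule sum.triangle_reindex)
  finally show ?thesis .
qed

lemma hom_decomposition:
  assumes "real_polynomial_function f"
  shows "\<exists>g n. (\<forall>i. hom_poly i (g i)) \<and> (\<forall>i\<ge>n. g i = (\<lambda>p. 0)) \<and> f = (\<lambda>p. \<Sum>i<n. g i p)"
  using assms
proof (induction rule: real_polynomial_function_coordinate_induct)
  case (const c)
  show ?case
    by (rule exI[of _ "\<lambda>i. if i = 0 then (\<lambda>p. c) else (\<lambda>p. 0)"], rule exI[of _ 1])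
      (auto intro: hom_poly.intros)
next
  case (nth i)
  show ?case
    by (rule exI[of _ "\<lambda>j. if j = 1 then (\<lambda>p. p$i) else (\<lambda>p. 0)"], rule exI[of _ 2])
      (auto intro: hom_poly.intros hom_poly.nth[simplified] simp: numeral_2_eq_2)
next
  case (add f f')
  then obtain g n g' n' where g: "\<forall>i. hom_poly i (g i)" "\<forall>i\<ge>n. g i = (\<lambda>p. 0)" "f = (\<lambda>p. \<Sum>i<n. g i p)"
    and g': "\<forall>i. hom_poly i (g' i)" "\<forall>i\<ge>n'. g' i = (\<lambda>p. 0)" "f' = (\<lambda>p. \<Sum>i<n'. g' i p)"
    by auto
  have "(\<Sum>i<n. g i p) = (\<Sum>i<max n n'. g i p)" for p
    by (rule sum.mono_neutral_left) (use g in auto)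
  moreover have "(\<Sum>i<n'. g' i p) = (\<Sum>i<max n n'. g' i p)" for p
    by (rule sum.mono_neutral_left) (use g' in auto)
  ultimately show ?case
    using g g'
    by (intro exI[of _ "\<lambda>i p. g i p + g' i p"] exI[of _ "max n n'"])
      (auto intro: hom_poly.intros simp: sum.distrib)
next
  case (mult f f')
  then obtain g n g' n' where g: "\<forall>i. hom_poly i (g i)" "\<forall>i\<ge>n. g i = (\<lambda>p. 0)" "f = (\<lambda>p. \<Sum>i<n. g i p)"
    and g': "\<forall>i. hom_poly i (g' i)" "\<forall>i\<ge>n'. g' i = (\<lambda>p. 0)" "f' = (\<lambda>p. \<Sum>i<n'. g' i p)"
    by auto
  let ?h = "\<lambda>k p. \<Sum>i\<le>k. g i p * g' (k - i) p"
  have "hom_poly k (?h k)" for k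
  proof (rule hom_poly_sum)
    fix i assume "i \<in> {..k}"
    then show "hom_poly k (\<lambda>p. g i p * g' (k - i) p)"
      using hom_poly.mult[of i "g i" "k - i" "g' (k - i)"] g g' by simp
  qed simp
  moreover have "?h k = (\<lambda>p. 0)" if "k \<ge> n + n'" for k
  proof
    fix p show "?h k p = 0"
    proof (rule sum.neutral, intro ballI)
      fix i
      show "g i p * g' (k - i) p = 0"
      proof (cases "i \<ge> n")
        case True then show ?thesis using g by simp
      next
        case False
        then have "k - i \<ge> n'" using that by simp
        then show ?thesis using g' by simp
      qed
    qed
  qed
  moreover have "f p * f' p = (\<Sum>k<n + n'. ?h k p)" for p
    unfolding g(3) g'(3) by (rule sum_cauchy_product) (use g g' in auto)
  ultimately show ?case
    by (intro exI[of _ ?h] exI[of _ "n + n'"]) auto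
qed

text \<open>At the point t p the sum is a polynomial in t whose coefficients are the components at
  p, and it vanishes for all t.\<close>

lemma hom_sum_eq_0:
  assumes "\<And>i. hom_poly i (g i)" and "\<And>p. (\<Sum>i<n. g i p) = 0" and "i < n"
  shows "g i p = 0"
proof -
  have "(\<Sum>i\<le>n - 1. g i p * t ^ i) = 0" for t
  proof -
    have "(\<Sum>i\<le>n - 1. g i p * t ^ i) = (\<Sum>i<n. g i (t *\<^sub>R p))"
      using assms(3) by (intro sum.cong) (auto simp: hom_poly_scale[OF assms(1)])
    then show ?thesis using assms(2) by simp
  qed
  then show ?thesis using polyfun_eq_0[of "\<lambda>i. g i p" "n - 1"] assms(3) by (auto simp: Suc_le_eq)
qed

section \<open>Leading coefficients of the normal form\<close>

lemma coeff_sq_mult: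
  fixes P :: "'k::comm_ring_1 poly"
  shows "coeff ([:c, 0, d:] * P) n = c * coeff P n + d * (if n < 2 then 0 else coeff P (n - 2))"
proof -
  consider "n = 0" | "n = 1" | m where "n = Suc (Suc m)"
    by (metis One_nat_def not0_implies_Suc)
  then show ?thesis by cases (auto simp: coeff_pCons)
qed

lemma coeff_quartic_mult:
  fixes P :: "'k::comm_ring_1 poly"
  shows "coeff ([:c, 0, d, 0, e:] * P) n = c * coeff P n + d * (if n < 2 then 0 else coeff P (n - 2))
    + e * (if n < 4 then 0 else coeff P (n - 4))"
proof -
  consider "n = 0" | "n = 1" | "n = 2" | "n = 3" | m where "n = Suc (Suc (Suc (Suc m)))"
    by (metis One_nat_def Suc_1 not0_implies_Suc numeral_3_eq_3)
  then show ?thesis by cases (auto simp: coeff_pCons eval_nat_numeral)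
qed

lemma coeff_cubic_mult:
  fixes P :: "'k::comm_ring_1 poly"
  shows "coeff ([:0, c, 0, d:] * P) n = c * (if n < 1 then 0 else coeff P (n - 1))
    + d * (if n < 3 then 0 else coeff P (n - 3))"
proof -
  consider "n = 0" | "n = 1" | "n = 2" | m where "n = Suc (Suc (Suc m))"
    by (metis One_nat_def Suc_1 not0_implies_Suc)
  then show ?thesis by cases (auto simp: coeff_pCons eval_nat_numeral)
qed

lemma coeff_linear_mult:
  fixes P :: "'k::comm_ring_1 poly"
  shows "coeff ([:0, c:] * P) n = c * (if n = 0 then 0 else coeff P (n - 1))"
  by (cases n) auto

lemma coeff_const_mult: "coeff ([:c:] * P) n = (c::'k::comm_ring_1) * coeff P n"
  by simp

text \<open>The sums c0 + c1, c2 + c3 and the differences c0 - c1, c3 - c2 decouple into two 2 by 2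
  systems. Their determinants are the two sums of squares; if neither vanished, all four
  coefficients would.\<close>

lemma leading_system:
  fixes c0 c1 c2 c3 p q s N :: "'k::idom"
  assumes "- N * c3 = p * c0 + q * c1 - s * c2"
    and "- N * c2 = p * c1 + q * c0 - s * c3"
    and "N * c1 = p * c2 + q * c3 + s * c0"
    and "N * c0 = p * c3 + q * c2 + s * c1"
    and two: "(2::'k) \<noteq> 0"
    and nz: "c0 \<noteq> 0 \<or> c1 \<noteq> 0 \<or> c2 \<noteq> 0 \<or> c3 \<noteq> 0"
  shows "(N - s)^2 + (p + q)^2 = 0 \<or> (N + s)^2 + (p - q)^2 = 0"
proof (rule ccontr)
  assume neg: "\<not> ?thesis"
  have a: "(N - s) * (c0 + c1) = (p + q) * (c2 + c3)"
    "- (N - s) * (c2 + c3) = (p + q) * (c0 + c1)"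
    "(N + s) * (c0 - c1) = (p - q) * (c3 - c2)"
    "- (N + s) * (c3 - c2) = (p - q) * (c0 - c1)"
    using assms(1-4) by algebra+
  have "((N - s)^2 + (p + q)^2) * (c0 + c1) = 0" "((N - s)^2 + (p + q)^2) * (c2 + c3) = 0"
    using a(1,2) by algebra+
  moreover have "((N + s)^2 + (p - q)^2) * (c0 - c1) = 0" "((N + s)^2 + (p - q)^2) * (c3 - c2) = 0"
    using a(3,4) by algebra+
  ultimately have e: "c0 + c1 = 0" "c2 + c3 = 0" "c0 - c1 = 0" "c3 - c2 = 0"
    using neg by auto
  have "2 * c0 = (c0 + c1) + (c0 - c1)" "2 * c1 = (c0 + c1) - (c0 - c1)"
    "2 * c3 = (c2 + c3) + (c3 - c2)" "2 * c2 = (c2 + c3) - (c3 - c2)"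
    by (simp_all add: algebra_simps)
  then have "2 * c0 = 0" "2 * c1 = 0" "2 * c2 = 0" "2 * c3 = 0"
    by (simp_all add: e)
  with two nz show False by simp
qed

text \<open>The four equations are the coefficients of 1, y, z, yz in \<open>L2 f = (p x + q y + s z) f\<close> for
  \<open>f = P0 + P1 y + P2 z + P3 y z\<close>, where \<open>Pi\<close> are polynomials in x over the integrals, reduced by
  \<open>y\<^sup>2 = x\<^sup>2 - A\<close> and \<open>z\<^sup>2 = B - x\<^sup>2\<close>.\<close>

lemma quadruple_eigen:
  fixes P0 P1 P2 P3 :: "'k::{idom,ring_char_0} poly" and A B p q s :: 'k
  assumes eq1: "[:-A, 0, 1:] * [:B, 0, -1:] * pderiv P3 + [:0, A + B, 0, -2:] * P3
      = [:0, p:] * P0 + [:q:] * [:-A, 0, 1:] * P1 + [:s:] * [:B, 0, -1:] * P2"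
    and eqy: "[:B, 0, -1:] * pderiv P2 - [:0, 1:] * P2
      = [:0, p:] * P1 + [:q:] * P0 + [:s:] * [:B, 0, -1:] * P3"
    and eqz: "[:-A, 0, 1:] * pderiv P1 + [:0, 1:] * P1
      = [:0, p:] * P2 + [:q:] * [:-A, 0, 1:] * P3 + [:s:] * P0"
    and eqyz: "pderiv P0 = [:0, p:] * P3 + [:q:] * P2 + [:s:] * P1"
    and nz: "P0 \<noteq> 0 \<or> P1 \<noteq> 0 \<or> P2 \<noteq> 0 \<or> P3 \<noteq> 0"
  shows "(\<exists>N. (of_nat N - s)^2 + (p + q)^2 = 0 \<or> (of_nat N + s)^2 + (p - q)^2 = 0) \<and>
    (p = 0 \<longrightarrow> q = 0 \<longrightarrow> s = 0 \<longrightarrow> P1 = 0 \<and> P2 = 0 \<and> P3 = 0 \<and> degree P0 = 0)"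
proof -
  \<comment> \<open>A weight in which x, y and z all count 1, as y^2 and z^2 grow like x^2 and -x^2:
    \<open>bnd m\<close> bounds the x-degrees of \<open>P0\<close>, \<open>P1\<close>,
    \<open>P2\<close>, \<open>P3\<close> by m, m - 1, m - 1, m - 2. The inequalities are arranged so
    that a negative bound means that the polynomial is zero.\<close>
  define bnd where "bnd m \<longleftrightarrow> (\<forall>i>m. coeff P0 i = 0) \<and> (\<forall>i\<ge>m. coeff P1 i = 0 \<and> coeff P2 i = 0) \<and>
    (\<forall>i. i + 1 \<ge> m \<longrightarrow> coeff P3 i = 0)" for m
  have "bnd (degree P0 + degree P1 + degree P2 + degree P3 + 2)"
    unfolding bnd_def by (auto intro: coeff_eq_0)
  define N where "N = (LEAST m. bnd m)"
  have bN: "bnd N" unfolding N_def by (rule LeastI) fact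
  have min: "\<not> bnd m" if "m < N" for m using that not_less_Least N_def by blast
  \<comment> \<open>The four coefficients of top weight; a coefficient of negative degree is read as
    0.\<close>
  define c0 c1 c2 c3 where "c0 = coeff P0 N" and "c1 = (if N = 0 then 0 else coeff P1 (N - 1))"
    and "c2 = (if N = 0 then 0 else coeff P2 (N - 1))" and "c3 = (if N < 2 then 0 else coeff P3 (N - 2))"
  have cnz: "c0 \<noteq> 0 \<or> c1 \<noteq> 0 \<or> c2 \<noteq> 0 \<or> c3 \<noteq> 0"
  proof (rule ccontr)
    assume "\<not> ?thesis"
    then have z: "c0 = 0" "c1 = 0" "c2 = 0" "c3 = 0" by auto
    show False
    proof (cases "N = 0")
      case True
      then have "coeff P0 i = 0" "coeff P1 i = 0" "coeff P2 i = 0" "coeff P3 i = 0" for i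
        using bN z(1) unfolding bnd_def c0_def by (cases i; simp)+
      then show False using nz by (metis poly_eqI coeff_0)
    next
      case False
      have "bnd (N - 1)"
        unfolding bnd_def
      proof (intro conjI allI impI)
        fix i assume "i > N - 1"
        then have "i = N \<or> i > N" by linarith
        then show "coeff P0 i = 0" using bN z(1) unfolding bnd_def c0_def by auto
      next
        fix i assume "i \<ge> N - 1"
        then have "i = N - 1 \<or> i \<ge> N" by linarith
        then show "coeff P1 i = 0" "coeff P2 i = 0"
          using bN z(2,3) False unfolding bnd_def c1_def c2_def by auto
      next
        fix i assume "i + 1 \<ge> N - 1"
        then have "(N \<ge> 2 \<and> i = N - 2) \<or> i + 1 \<ge> N" by linarith
        then show "coeff P3 i = 0"
          using bN z(4) False unfolding bnd_def c3_def by auto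
      qed
      with min[of "N - 1"] False show False by simp
    qed
  qed
  have v0: "coeff P0 i = 0" if "i > N" for i using bN that unfolding bnd_def by blast
  have v12: "coeff P1 i = 0" "coeff P2 i = 0" if "i \<ge> N" for i using bN that unfolding bnd_def by blast+
  have v3: "coeff P3 i = 0" if "i + 1 \<ge> N" for i using bN that unfolding bnd_def by blast
  have quart: "[:-A, 0, 1:] * [:B, 0, -1:] = [:-(A*B), 0, A + B, 0, -1:]" by simp
  \<comment> \<open>Derivation and cofactor both raise the weight by one, so the components 1, y, z,
    yz of the equation are compared at x^(N+1), x^N, x^N and x^(N-1).\<close>
  have 4: "of_nat N * c0 = p * c3 + q * c2 + s * c1"
  proof (cases N)
    case (Suc n)
    have "coeff (pderiv P0) n = coeff ([:0, p:] * P3 + [:q:] * P2 + [:s:] * P1) n" using eqyz by simp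
    then show ?thesis
      using Suc unfolding coeff_add coeff_linear_mult
      by (auto simp: coeff_pderiv c0_def c1_def c2_def c3_def v3)
  qed (simp add: c1_def c2_def c3_def)
  have 3: "of_nat N * c1 = p * c2 + q * c3 + s * c0"
  proof -
    have "coeff ([:-A, 0, 1:] * pderiv P1 + [:0, 1:] * P1) N =
      coeff ([:0, p:] * P2 + [:q:] * [:-A, 0, 1:] * P3 + [:s:] * P0) N" using eqz by simp
    moreover have "coeff ([:-A, 0, 1:] * pderiv P1 + [:0, 1:] * P1) N = of_nat N * c1"
    proof -
      consider "N = 0" | "N = 1" | n where "N = Suc (Suc n)" by (metis One_nat_def not0_implies_Suc)
      then show ?thesis unfolding coeff_add coeff_linear_mult coeff_sq_mult
        by cases (auto simp: coeff_pderiv c1_def v12 algebra_simps)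
    qed
    moreover have "coeff ([:0, p:] * P2 + [:q:] * [:-A, 0, 1:] * P3 + [:s:] * P0) N = p * c2 + q * c3 + s * c0"
      unfolding coeff_add coeff_linear_mult mult.assoc
      by (simp add: coeff_const_mult coeff_sq_mult v3 c0_def c2_def c3_def del: mult_pCons_left)
    ultimately show ?thesis by simp
  qed
  have 2: "- of_nat N * c2 = p * c1 + q * c0 - s * c3"
  proof -
    have "coeff ([:B, 0, -1:] * pderiv P2 - [:0, 1:] * P2) N =
      coeff ([:0, p:] * P1 + [:q:] * P0 + [:s:] * [:B, 0, -1:] * P3) N" using eqy by simp
    moreover have "coeff ([:B, 0, -1:] * pderiv P2 - [:0, 1:] * P2) N = - of_nat N * c2"
    proof -
      consider "N = 0" | "N = 1" | n where "N = Suc (Suc n)" by (metis One_nat_def not0_implies_Suc)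
      then show ?thesis unfolding coeff_diff coeff_linear_mult coeff_sq_mult
        by cases (auto simp: coeff_pderiv c2_def v12 algebra_simps)
    qed
    moreover have "coeff ([:0, p:] * P1 + [:q:] * P0 + [:s:] * [:B, 0, -1:] * P3) N = p * c1 + q * c0 - s * c3"
      unfolding coeff_add coeff_linear_mult mult.assoc
      by (simp add: coeff_const_mult coeff_sq_mult v3 c0_def c1_def c3_def del: mult_pCons_left)
    ultimately show ?thesis by simp
  qed
  have 1: "- of_nat N * c3 = p * c0 + q * c1 - s * c2"
  proof -
    have "coeff ([:-(A*B), 0, A + B, 0, -1:] * pderiv P3 + [:0, A + B, 0, -2:] * P3) (Suc N) =
      coeff ([:0, p:] * P0 + [:q:] * [:-A, 0, 1:] * P1 + [:s:] * [:B, 0, -1:] * P2) (Suc N)"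
      using eq1 unfolding quart by simp
    moreover have "coeff ([:-(A*B), 0, A + B, 0, -1:] * pderiv P3 + [:0, A + B, 0, -2:] * P3) (Suc N) = - of_nat N * c3"
    proof -
      consider "N = 0" | "N = 1" | "N = 2" | n where "N = Suc (Suc (Suc n))"
        by (metis One_nat_def Suc_1 not0_implies_Suc)
      then show ?thesis unfolding coeff_add coeff_cubic_mult coeff_quartic_mult
        by cases (auto simp: coeff_pderiv c3_def v3 algebra_simps eval_nat_numeral)
    qed
    moreover have "coeff ([:0, p:] * P0 + [:q:] * [:-A, 0, 1:] * P1 + [:s:] * [:B, 0, -1:] * P2) (Suc N) = p * c0 + q * c1 - s * c2"
      unfolding coeff_add coeff_linear_mult mult.assoc
      by (simp add: coeff_const_mult coeff_sq_mult v12 c0_def c1_def c2_def del: mult_pCons_left)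
    ultimately show ?thesis by simp
  qed
  have main: "(of_nat N - s)^2 + (p + q)^2 = 0 \<or> (of_nat N + s)^2 + (p - q)^2 = 0"
    by (rule leading_system[OF 1 2 3 4 _ cnz]) simp
  \<comment> \<open>For cofactor 0 both alternatives read N^2 = 0: a polynomial of weight 0 lies in
    the ring of integrals.\<close>
  moreover have "P1 = 0 \<and> P2 = 0 \<and> P3 = 0 \<and> degree P0 = 0" if "p = 0" "q = 0" "s = 0"
  proof -
    have "N = 0" using main that by simp
    then have "coeff P1 i = 0" "coeff P2 i = 0" "coeff P3 i = 0" for i
      using v12 v3 by auto
    moreover have "degree P0 = 0" using v0 \<open>N = 0\<close> by (metis degree_0 gr0I leading_coeff_0_iff)
    ultimately show ?thesis by (simp add: poly_eq_iff)
  qed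
  ultimately show ?thesis by blast
qed

text \<open>If \<open>P3\<close> has degree d, the left side has at x^(d+3) the coefficient -(d + 2)
  times the leading coefficient of \<open>P3\<close>. This degree is too high for the right side, so
  \<open>P3\<close> = 0. The equation is the component of 1 in L2 f = \<alpha> + \<beta> x^2, where
  only \<open>P3\<close> occurs; the elliptic obstruction becomes a degree count.\<close>

lemma quadruple_not_exact:
  fixes P3 :: "'k::{idom,ring_char_0} poly" and A B \<alpha> \<beta> :: 'k
  assumes eq1: "[:-A, 0, 1:] * [:B, 0, -1:] * pderiv P3 + [:0, A + B, 0, -2:] * P3 = [:\<alpha>, 0, \<beta>:]"
  shows "\<alpha> = 0 \<and> \<beta> = 0"
proof -
  have "P3 = 0"
  proof (rule ccontr)
    assume "P3 \<noteq> 0"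
    have quart: "[:-A, 0, 1:] * [:B, 0, -1:] = [:-(A*B), 0, A + B, 0, -1:]" by simp
    define d where "d = degree P3"
    have z: "coeff P3 i = 0" if "i > d" for i using that d_def by (simp add: coeff_eq_0)
    have "coeff ([:-(A*B), 0, A + B, 0, -1:] * pderiv P3 + [:0, A + B, 0, -2:] * P3) (d + 3) = coeff [:\<alpha>, 0, \<beta>:] (d + 3)"
      using eq1 unfolding quart by simp
    moreover have "coeff ([:-(A*B), 0, A + B, 0, -1:] * pderiv P3 + [:0, A + B, 0, -2:] * P3) (d + 3) = - of_nat (d + 2) * coeff P3 d"
      unfolding coeff_add coeff_cubic_mult coeff_quartic_mult
      by (cases d) (auto simp: coeff_pderiv z algebra_simps eval_nat_numeral)
    moreover have "coeff [:\<alpha>, 0, \<beta>:] (d + 3) = 0" by (simp add: eval_nat_numeral)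
    ultimately have "- of_nat (d + 2) * coeff P3 d = 0" by (simp only:)
    then have "of_nat (d + 2) * coeff P3 d = 0" by (metis mult_minus_left neg_equal_0_iff_equal)
    moreover have "of_nat (d + 2) \<noteq> (0::'k)" by (metis add_is_0 of_nat_eq_0_iff zero_neq_numeral)
    ultimately show False using \<open>P3 \<noteq> 0\<close> d_def by simp
  qed
  then show ?thesis using eq1 by simp
qed

section \<open>Normal form over the ring of first integrals of the quadratic part\<close>

definition linear_part :: "real \<Rightarrow> real \<Rightarrow> real^3 \<Rightarrow> real^3" where
  "linear_part a b p = vector [a * p$1, b * p$2, p$3]"

definition quadratic_part :: "real^3 \<Rightarrow> real^3" where
  "quadratic_part p = vector [p$2 * p$3, p$1 * p$3, - (p$1 * p$2)]"

lemma linear_part_nth [simp]: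
  "linear_part a b p $ 1 = a * p$1" "linear_part a b p $ 2 = b * p$2" "linear_part a b p $ 3 = p$3"
  by (simp_all add: linear_part_def)

lemma quadratic_part_nth [simp]:
  "quadratic_part p $ 1 = p$2 * p$3" "quadratic_part p $ 2 = p$1 * p$3" "quadratic_part p $ 3 = - (p$1 * p$2)"
  by (simp_all add: quadratic_part_def)

lemma X_field_decomp: "X_field a b = (\<lambda>p. linear_part a b p + quadratic_part p)"
  by (rule ext) (simp add: vec_eq_iff forall_3 X_field_def)

abbreviation L1 :: "real \<Rightarrow> real \<Rightarrow> (real^3 \<Rightarrow> real) \<Rightarrow> real^3 \<Rightarrow> real" where
  "L1 a b \<equiv> lie_derivative (linear_part a b)"

abbreviation L2 :: "(real^3 \<Rightarrow> real) \<Rightarrow> real^3 \<Rightarrow> real" where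
  "L2 \<equiv> lie_derivative quadratic_part"

lemma real_polynomial_function_H [simp]: "real_polynomial_function H_ab" "real_polynomial_function H_b"
  unfolding H_ab_def H_b_def by simp_all

lemma L2_H [simp]: "L2 H_ab p = 0" "L2 H_b p = 0"
  unfolding H_ab_def[abs_def] H_b_def[abs_def] by simp_all

lemma L1_H:
  "L1 a b H_ab p = 2 * (a - b) * (p$1)\<^sup>2 + 2 * b * H_ab p"
  "L1 a b H_b p = 2 * (a - 1) * (p$1)\<^sup>2 + 2 * H_b p"
  by (simp_all add: H_ab_def[abs_def] H_b_def[abs_def] algebra_simps power2_eq_square)

type_synonym ring_K = "real poly poly"

text \<open>An element of \<open>ring_K\<close> is a polynomial in the two integrals \<open>H_ab\<close> (outer variable) and
  \<open>H_b\<close> (inner variable).\<close>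

definition evK :: "ring_K \<Rightarrow> real^3 \<Rightarrow> real" where
  "evK F p = poly (poly F [:H_ab p:]) (H_b p)"

definition VA :: ring_K where "VA = [:0, 1:]"
definition VB :: ring_K where "VB = [:[:0, 1:]:]"

lemma evK_simps [simp]:
  "evK 0 p = 0" "evK 1 p = 1" "evK (F + G) p = evK F p + evK G p" "evK (F - G) p = evK F p - evK G p"
  "evK (- F) p = - evK F p" "evK (F * G) p = evK F p * evK G p" "evK (F ^ n) p = evK F p ^ n"
  "evK VA p = H_ab p" "evK VB p = H_b p" "evK [:[:c:]:] p = c"
  by (simp_all add: evK_def VA_def VB_def)

lemma evK_numeral [simp]: "evK (numeral n) p = numeral n"
  using evK_simps(10)[of "numeral n"] by (simp add: numeral_poly)

lemma evK_smult [simp]: "evK (smult c F) p = poly c (H_b p) * evK F p"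
  by (simp add: evK_def)

lemma evK_pCons: "evK (pCons c F) p = poly c (H_b p) + H_ab p * evK F p"
  by (simp add: evK_def)

definition evP :: "ring_K poly \<Rightarrow> real^3 \<Rightarrow> real" where
  "evP P p = evK (poly P [:[:p$1:]:]) p"

lemma evP_0 [simp]: "evP 0 p = 0"
  by (simp add: evP_def)

lemma evP_pCons [simp]: "evP (pCons c P) p = evK c p + p$1 * evP P p"
  by (simp add: evP_def)

lemma evP_smult [simp]: "evP (smult c P) p = evK c p * evP P p"
  by (simp add: evP_def)

lemma evP_arith [simp]:
  "evP (P + Q) p = evP P p + evP Q p" "evP (P - Q) p = evP P p - evP Q p" "evP (- P) p = - evP P p" "evP (P * Q) p = evP P p * evP Q p"
  by (simp_all add: evP_def)

lemma real_polynomial_function_poly: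
  assumes "real_polynomial_function g"
  shows "real_polynomial_function (\<lambda>p. poly c (g p))"
  by (induction c) (use assms in auto)

lemma real_polynomial_function_evK [simp]: "real_polynomial_function (evK F)"
proof (induction F)
  case 0
  then show ?case unfolding evK_def by simp
next
  case (pCons c F)
  have "evK (pCons c F) = (\<lambda>p. poly c (H_b p) + H_ab p * evK F p)"
    by (rule ext) (rule evK_pCons)
  then show ?case using pCons real_polynomial_function_poly[OF real_polynomial_function_H(2)] by simp
qed

lemma real_polynomial_function_evP [simp]: "real_polynomial_function (evP P)"
proof (induction P)
  case 0
  then show ?case unfolding evP_def by simp
next
  case (pCons c P)
  have "evP (pCons c P) = (\<lambda>p. evK c p + p$1 * evP P p)"
    by (rule ext) simp
  then show ?case using pCons by simp
qed

lemma lie_poly: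
  assumes "real_polynomial_function g"
  shows "lie_derivative X (\<lambda>p. poly c (g p)) p = poly (pderiv c) (g p) * lie_derivative X g p"
proof (induction c)
  case (pCons c P)
  then show ?case
    using assms by (simp add: pderiv_pCons real_polynomial_function_poly algebra_simps)
qed simp

text \<open>Chain rule in the two integrals: \<open>pderiv\<close> differentiates in the outer
  variable \<open>H_ab\<close>, \<open>map_poly pderiv\<close> in the inner variable
  \<open>H_b\<close>.\<close>

lemma lie_evK:
  "lie_derivative X (evK F) p =
    evK (pderiv F) p * lie_derivative X H_ab p + evK (map_poly pderiv F) p * lie_derivative X H_b p"
proof (induction F)
  case 0
  then show ?case unfolding evK_def by simp
next
  case (pCons c F)
  have "evK (pCons c F) = (\<lambda>p. poly c (H_b p) + H_ab p * evK F p)"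
    by (rule ext) (rule evK_pCons)
  then show ?case
    using pCons
    by (simp add: lie_poly real_polynomial_function_poly pderiv_pCons map_poly_pCons evK_pCons algebra_simps)
qed

lemma L2_evK [simp]: "L2 (evK F) p = 0"
  by (simp add: lie_evK)

lemma L1_evK: "L1 a b (evK F) p =
    evK (pderiv F) p * (2 * (a - b) * (p$1)\<^sup>2 + 2 * b * H_ab p)
    + evK (map_poly pderiv F) p * (2 * (a - 1) * (p$1)\<^sup>2 + 2 * H_b p)"
  by (simp add: lie_evK L1_H)

lemma L2_evP [simp]: "L2 (evP P) p = p$2 * p$3 * evP (pderiv P) p"
proof (induction P)
  case 0
  then show ?case unfolding evP_def by simp
next
  case (pCons c P)
  have "evP (pCons c P) = (\<lambda>p. evK c p + p$1 * evP P p)"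
    by (rule ext) simp
  then show ?case using pCons by (simp add: pderiv_pCons algebra_simps)
qed

section \<open>The free basis 1, y, z, yz: existence and uniqueness of coordinates\<close>

definition ev4 :: "ring_K poly \<Rightarrow> ring_K poly \<Rightarrow> ring_K poly \<Rightarrow> ring_K poly \<Rightarrow> real^3 \<Rightarrow> real" where
  "ev4 P0 P1 P2 P3 = (\<lambda>p. evP P0 p + evP P1 p * p$2 + evP P2 p * p$3 + evP P3 p * (p$2 * p$3))"

definition sqY :: "ring_K poly" where "sqY = [:- VA, 0, 1:]"
definition sqZ :: "ring_K poly" where "sqZ = [:VB, 0, -1:]"

lemma evP_sq [simp]: "evP sqY p = (p$2)\<^sup>2" "evP sqZ p = (p$3)\<^sup>2"
  by (simp_all add: sqY_def sqZ_def H_ab_def H_b_def power2_eq_square)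

text \<open>The four-term shape is closed under products because y^2 = x^2 - A and z^2 = B - x^2,
  encoded by \<open>sqY\<close> and \<open>sqZ\<close>, lie in the coefficient ring.\<close>

lemma ex_normal_form:
  assumes "real_polynomial_function f"
  shows "\<exists>P0 P1 P2 P3. f = ev4 P0 P1 P2 P3"
  using assms
proof (induction rule: real_polynomial_function_coordinate_induct)
  case (const c)
  have "(\<lambda>p. c) = ev4 [:[:[:c:]:]:] 0 0 0" by (simp add: ev4_def)
  then show ?case by blast
next
  case (nth i)
  have "(\<lambda>p. p$1) = ev4 [:0, 1:] 0 0 0" "(\<lambda>p. p$2) = ev4 0 [:1:] 0 0" "(\<lambda>p. p$3) = ev4 0 0 [:1:] 0"
    by (simp_all add: ev4_def)
  moreover consider "i = 1" | "i = 2" | "i = 3" using exhaust_3 by blast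
  ultimately show ?case by cases (simp, blast)+
next
  case (add f g)
  then obtain P0 P1 P2 P3 Q0 Q1 Q2 Q3 where "f = ev4 P0 P1 P2 P3" "g = ev4 Q0 Q1 Q2 Q3" by blast
  then have "(\<lambda>p. f p + g p) = ev4 (P0 + Q0) (P1 + Q1) (P2 + Q2) (P3 + Q3)"
    by (simp add: ev4_def algebra_simps)
  then show ?case by blast
next
  case (mult f g)
  then obtain P0 P1 P2 P3 Q0 Q1 Q2 Q3 where "f = ev4 P0 P1 P2 P3" "g = ev4 Q0 Q1 Q2 Q3" by blast
  then have "(\<lambda>p. f p * g p) = ev4
    (P0 * Q0 + sqY * (P1 * Q1) + sqZ * (P2 * Q2) + sqY * (sqZ * (P3 * Q3)))
    (P0 * Q1 + P1 * Q0 + sqZ * (P2 * Q3 + P3 * Q2))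
    (P0 * Q2 + P2 * Q0 + sqY * (P1 * Q3 + P3 * Q1))
    (P0 * Q3 + P3 * Q0 + P1 * Q2 + P2 * Q1)"
    by (simp add: ev4_def algebra_simps power2_eq_square)
  then show ?case by blast
qed

text \<open>Algebraic independence of x, A and B. Every triple with A < x^2 < B is attained at a
  real point with y and z nonzero, so for fixed x and A there are infinitely many roots B, then
  infinitely many constant roots A, and finally infinitely many roots x.\<close>

lemma evP_eq_0:
  assumes "\<And>x y z. y \<noteq> 0 \<Longrightarrow> z \<noteq> 0 \<Longrightarrow> evP P (vector [x, y, z]) = 0"
  shows "P = 0"
proof -
  have *: "poly P [:[:x:]:] = 0" for x
  proof (rule ccontr)
    let ?Q = "poly P [:[:x:]:]"
    assume "?Q \<noteq> 0"
    then have fin: "finite {c. poly ?Q c = 0}" by (rule poly_roots_finite)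
    have "poly ?Q [:A:] = 0" if "A < x\<^sup>2" for A
    proof (rule ccontr)
      assume "poly ?Q [:A:] \<noteq> 0"
      then have "finite {B. poly (poly ?Q [:A:]) B = 0}" by (rule poly_roots_finite)
      moreover have "{x\<^sup>2<..} \<subseteq> {B. poly (poly ?Q [:A:]) B = 0}"
      proof
        fix B assume "B \<in> {x\<^sup>2<..}"
        then have "evP P (vector [x, sqrt (x\<^sup>2 - A), sqrt (B - x\<^sup>2)]) = 0"
          using that by (intro assms) auto
        then show "B \<in> {B. poly (poly ?Q [:A:]) B = 0}"
          using that \<open>B \<in> {x\<^sup>2<..}\<close> by (simp add: evP_def evK_def H_ab_def H_b_def)
      qed
      ultimately show False using infinite_Ioi finite_subset by blast
    qed
    then have "(\<lambda>A. [:A:]) ` {..<x\<^sup>2} \<subseteq> {c. poly ?Q c = 0}" by auto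
    then have "finite ((\<lambda>A. [:A:]) ` {..<x\<^sup>2})" using fin finite_subset by blast
    then have "finite {..<x\<^sup>2}" by (rule finite_imageD) (simp add: inj_on_def)
    then show False using infinite_Iio by blast
  qed
  show "P = 0"
  proof (rule ccontr)
    assume "P \<noteq> 0"
    then have fin: "finite {c. poly P c = 0}" by (rule poly_roots_finite)
    have "range (\<lambda>x::real. [:[:x:]:]) \<subseteq> {c. poly P c = 0}" using * by auto
    then have "finite (range (\<lambda>x::real. [:[:x:]:]))" using fin finite_subset by blast
    then have "finite (UNIV::real set)" by (rule finite_imageD) (simp add: inj_on_def)
    then show False using infinite_UNIV_char_0 by blast
  qed
qed

text \<open>Changing the signs of y and z fixes x, A and B. The four resulting equations isolate the
  four terms, and y and z cancel where they are nonzero.\<close>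

lemma ev4_eq_0:
  assumes "\<And>p. ev4 P0 P1 P2 P3 p = 0"
  shows "P0 = 0 \<and> P1 = 0 \<and> P2 = 0 \<and> P3 = 0"
proof -
  have "evP P0 (vector [x, y, z]) = 0 \<and> evP P1 (vector [x, y, z]) = 0 \<and>
    evP P2 (vector [x, y, z]) = 0 \<and> evP P3 (vector [x, y, z]) = 0" if "y \<noteq> 0" "z \<noteq> 0" for x y z
  proof -
    have e: "evP P (vector [x, - y, z]) = evP P (vector [x, y, z])"
      "evP P (vector [x, y, - z]) = evP P (vector [x, y, z])"
      "evP P (vector [x, - y, - z]) = evP P (vector [x, y, z])" for P
      by (simp_all add: evP_def evK_def H_ab_def H_b_def)
    let ?e = "\<lambda>P. evP P (vector [x, y, z])"
    have "?e P0 + ?e P1 * y + ?e P2 * z + ?e P3 * (y * z) = 0"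
      "?e P0 - ?e P1 * y + ?e P2 * z - ?e P3 * (y * z) = 0"
      "?e P0 + ?e P1 * y - ?e P2 * z - ?e P3 * (y * z) = 0"
      "?e P0 - ?e P1 * y - ?e P2 * z + ?e P3 * (y * z) = 0"
      using assms[of "vector [x, y, z]"] assms[of "vector [x, - y, z]"]
        assms[of "vector [x, y, - z]"] assms[of "vector [x, - y, - z]"]
      by (simp_all add: ev4_def e)
    then have "?e P0 = 0" "?e P1 * y = 0" "?e P2 * z = 0" "?e P3 * (y * z) = 0" by linarith+
    then show ?thesis using that by simp
  qed
  then show ?thesis using evP_eq_0 by meson
qed

lemma L2_ev4:
  "L2 (ev4 P0 P1 P2 P3) = ev4
    (sqY * sqZ * pderiv P3 + [:0, VA + VB, 0, -2:] * P3)
    (sqZ * pderiv P2 - [:0, 1:] * P2)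
    (sqY * pderiv P1 + [:0, 1:] * P1)
    (pderiv P0)"
proof
  fix p
  show "L2 (ev4 P0 P1 P2 P3) p = ev4
    (sqY * sqZ * pderiv P3 + [:0, VA + VB, 0, -2:] * P3)
    (sqZ * pderiv P2 - [:0, 1:] * P2)
    (sqY * pderiv P1 + [:0, 1:] * P1)
    (pderiv P0) p"
    unfolding ev4_def
    by (simp add: H_ab_def H_b_def algebra_simps power2_eq_square)
qed

lemma linear_mult_ev4:
  "(\<lambda>v. (p * v$1 + q * v$2 + s * v$3) * ev4 P0 P1 P2 P3 v) = ev4
    ([:0, [:[:p:]:]:] * P0 + [:[:[:q:]:]:] * sqY * P1 + [:[:[:s:]:]:] * sqZ * P2)
    ([:0, [:[:p:]:]:] * P1 + [:[:[:q:]:]:] * P0 + [:[:[:s:]:]:] * sqZ * P3)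
    ([:0, [:[:p:]:]:] * P2 + [:[:[:q:]:]:] * sqY * P3 + [:[:[:s:]:]:] * P0)
    ([:0, [:[:p:]:]:] * P3 + [:[:[:q:]:]:] * P2 + [:[:[:s:]:]:] * P1)"
proof
  fix v
  show "(p * v$1 + q * v$2 + s * v$3) * ev4 P0 P1 P2 P3 v = ev4
    ([:0, [:[:p:]:]:] * P0 + [:[:[:q:]:]:] * sqY * P1 + [:[:[:s:]:]:] * sqZ * P2)
    ([:0, [:[:p:]:]:] * P1 + [:[:[:q:]:]:] * P0 + [:[:[:s:]:]:] * sqZ * P3)
    ([:0, [:[:p:]:]:] * P2 + [:[:[:q:]:]:] * sqY * P3 + [:[:[:s:]:]:] * P0)
    ([:0, [:[:p:]:]:] * P3 + [:[:[:q:]:]:] * P2 + [:[:[:s:]:]:] * P1) v"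
    unfolding ev4_def
    by (simp add: H_ab_def H_b_def algebra_simps power2_eq_square)
qed

lemma ev4_inject:
  assumes "ev4 P0 P1 P2 P3 = ev4 Q0 Q1 Q2 Q3"
  shows "P0 = Q0 \<and> P1 = Q1 \<and> P2 = Q2 \<and> P3 = Q3"
proof -
  have "ev4 (P0 - Q0) (P1 - Q1) (P2 - Q2) (P3 - Q3) p = 0" for p
    using fun_cong[OF assms, of p] by (simp add: ev4_def algebra_simps)
  then show ?thesis using ev4_eq_0 by (metis eq_iff_diff_eq_0)
qed

section \<open>Darboux polynomials of the quadratic part\<close>

text \<open>Uniqueness of the normal form turns the eigenvalue equation into four equations over the
  ring of integrals. As p, q, s and N are constants of that ring, the outcome is an equation between
  real numbers.\<close>

lemma L2_eigen:
  assumes f: "real_polynomial_function f" and nz: "f u \<noteq> 0"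
    and eig: "\<And>v. L2 f v = (p * v$1 + q * v$2 + s * v$3) * f v"
  shows "\<exists>N::nat. (s = real N \<and> q = - p) \<or> (s = - real N \<and> q = p)"
    and "p = 0 \<Longrightarrow> q = 0 \<Longrightarrow> s = 0 \<Longrightarrow> \<exists>C. f = evK C"
proof -
  obtain P0 P1 P2 P3 where P: "f = ev4 P0 P1 P2 P3" using ex_normal_form[OF f] by blast
  have nzP: "P0 \<noteq> 0 \<or> P1 \<noteq> 0 \<or> P2 \<noteq> 0 \<or> P3 \<noteq> 0"
    using nz unfolding P by (auto simp: ev4_def)
  have "L2 (ev4 P0 P1 P2 P3) = (\<lambda>v. (p * v$1 + q * v$2 + s * v$3) * ev4 P0 P1 P2 P3 v)"
    using eig unfolding P by blast
  from ev4_inject[OF this[unfolded L2_ev4 linear_mult_ev4]]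
  have eqs: "sqY * sqZ * pderiv P3 + [:0, VA + VB, 0, -2:] * P3 =
      [:0, [:[:p:]:]:] * P0 + [:[:[:q:]:]:] * sqY * P1 + [:[:[:s:]:]:] * sqZ * P2"
    "sqZ * pderiv P2 - [:0, 1:] * P2 = [:0, [:[:p:]:]:] * P1 + [:[:[:q:]:]:] * P0 + [:[:[:s:]:]:] * sqZ * P3"
    "sqY * pderiv P1 + [:0, 1:] * P1 = [:0, [:[:p:]:]:] * P2 + [:[:[:q:]:]:] * sqY * P3 + [:[:[:s:]:]:] * P0"
    "pderiv P0 = [:0, [:[:p:]:]:] * P3 + [:[:[:q:]:]:] * P2 + [:[:[:s:]:]:] * P1"
    by blast+
  note E = quadruple_eigen[OF eqs[unfolded sqY_def sqZ_def] nzP]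
  obtain N :: nat where "(of_nat N - [:[:s:]:])^2 + ([:[:p:]:] + [:[:q:]:])^2 = (0::ring_K) \<or>
    (of_nat N + [:[:s:]:])^2 + ([:[:p:]:] - [:[:q:]:])^2 = (0::ring_K)"
    using E by blast
  moreover have "(of_nat N - [:[:s:]:])^2 + ([:[:p:]:] + [:[:q:]:])^2 = [:[:(N - s)^2 + (p + q)^2:]:]"
    "(of_nat N + [:[:s:]:])^2 + ([:[:p:]:] - [:[:q:]:])^2 = [:[:(N + s)^2 + (p - q)^2:]:]"
    by (simp_all add: of_nat_poly power2_eq_square)
  ultimately have "(N - s)^2 + (p + q)^2 = 0 \<or> (N + s)^2 + (p - q)^2 = 0" by (metis pCons_eq_0_iff)
  then show "\<exists>N::nat. (s = real N \<and> q = - p) \<or> (s = - real N \<and> q = p)"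
    by (intro exI[of _ N]) (auto simp: sum_power2_eq_zero_iff)
  show "\<exists>C. f = evK C" if z: "p = 0" "q = 0" "s = 0"
  proof -
    have "P1 = 0" "P2 = 0" "P3 = 0" "degree P0 = 0" using E z by auto
    moreover then obtain C where "P0 = [:C:]" by (metis degree_eq_zeroE)
    ultimately have "f = evK C" unfolding P by (auto simp: ev4_def)
    then show ?thesis by blast
  qed
qed

lemma L2_not_exact:
  assumes f: "real_polynomial_function f"
    and eq: "\<And>v. L2 f v = evK \<alpha> v + evK \<beta> v * (v$1)\<^sup>2"
  shows "\<alpha> = 0 \<and> \<beta> = 0"
proof -
  obtain P0 P1 P2 P3 where P: "f = ev4 P0 P1 P2 P3" using ex_normal_form[OF f] by blast
  have "L2 (ev4 P0 P1 P2 P3) = ev4 [:\<alpha>, 0, \<beta>:] 0 0 0"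
    using eq unfolding P by (auto simp: ev4_def[of "[:\<alpha>, 0, \<beta>:]"] power2_eq_square)
  from ev4_inject[OF this[unfolded L2_ev4]]
  have "sqY * sqZ * pderiv P3 + [:0, VA + VB, 0, -2:] * P3 = [:\<alpha>, 0, \<beta>:]" by blast
  then show ?thesis unfolding sqY_def sqZ_def by (rule quadruple_not_exact)
qed

section \<open>The symmetry x -> -x of the quadratic part\<close>

definition reflect :: "real^3 \<Rightarrow> real^3" where
  "reflect p = vector [- p$1, p$2, p$3]"

text \<open>The reflection maps the field (yz, xz, -xy) to its negative, so pulling back along it
  anticommutes with L2.\<close>

lemma L2_reflect:
  assumes "real_polynomial_function f"
  shows "real_polynomial_function (\<lambda>p. f (reflect p)) \<and> (\<forall>p. L2 (\<lambda>p. f (reflect p)) p = - L2 f (reflect p))"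
  using assms
proof (induction rule: real_polynomial_function_coordinate_induct)
  case (nth i)
  consider "i = 1" | "i = 2" | "i = 3" using exhaust_3 by blast
  then show ?case by cases (simp_all add: reflect_def)
qed (auto simp: algebra_simps)

text \<open>The product of a Darboux polynomial with its mirror image has cofactor \<open>2 p x\<close>, which
  kills the coefficient \<open>p\<close>.\<close>

lemma L2_cofactor:
  assumes f: "real_polynomial_function f" and nz: "f u \<noteq> 0"
    and eig: "\<And>v. L2 f v = (p * v$1 + q * v$2 + s * v$3) * f v"
  shows "p = 0 \<and> q = 0 \<and> (\<exists>N. s = real N \<or> s = - real N)"
proof -
  let ?g = "\<lambda>v. f (reflect v)"
  have g: "real_polynomial_function ?g" "\<And>v. L2 ?g v = - L2 f (reflect v)"
    using L2_reflect[OF f] by auto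
  have r: "reflect (reflect u) = u" by (simp add: reflect_def vec_eq_iff forall_3)
  obtain w where "f w * ?g w \<noteq> 0"
    using real_polynomial_function_mult_eq_0[OF f g(1), of u "reflect u"] nz r by fastforce
  moreover have "L2 (\<lambda>v. f v * ?g v) v = (2 * p * v$1 + 0 * v$2 + 0 * v$3) * (f v * ?g v)" for v
  proof -
    have "L2 ?g v = (p * v$1 - q * v$2 - s * v$3) * ?g v"
      unfolding g(2) eig by (simp add: reflect_def algebra_simps)
    moreover have "L2 (\<lambda>v. f v * ?g v) v = f v * L2 ?g v + L2 f v * ?g v"
      using f g(1) by (rule lie_mult)
    ultimately show ?thesis by (simp only: eig) (simp add: algebra_simps)
  qed
  \<comment> \<open>The product has no y- and z-part in its cofactor, and there the relation q = -p
    or q = p reads 2 p = 0.\<close>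
  ultimately have "p = 0"
    using L2_eigen(1)[of "\<lambda>v. f v * ?g v" w "2 * p" 0 0] f g by auto
  then show ?thesis using L2_eigen(1)[OF f nz eig] by auto
qed

text \<open>Put u = x + \<sigma> y and w = x - \<sigma> y, so A = u w. At (1, \<sigma>, sqrt(B - 1))
  w vanishes and u does not; hence the coefficient of A^0 in C vanishes for all B > 1, and A divides
  C. Cancelling w leaves one more factor u on the right, which is why M varies in the
  induction.\<close>

lemma divide_out_linear_factor:
  assumes g: "real_polynomial_function g" and sg: "\<sigma>\<^sup>2 = (1::real)"
    and eq: "\<And>p. (p$1 - \<sigma> * p$2) ^ N * g p = (p$1 + \<sigma> * p$2) ^ M * evK C p"
  shows "\<exists>F. \<forall>p. g p = (p$1 + \<sigma> * p$2) ^ (M + N) * evK F p"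
  using eq
proof (induction N arbitrary: M C)
  case 0
  then show ?case by auto
next
  case (Suc N)
  obtain c D where C: "C = pCons c D" by (cases C)
  have ss: "\<sigma> * \<sigma> = 1" using sg by (simp add: power2_eq_square)
  have "c = 0"
  proof (rule ccontr)
    assume "c \<noteq> 0"
    then have "finite {B. poly c B = 0}" by (rule poly_roots_finite)
    moreover have "{1<..} \<subseteq> {B. poly c B = 0}"
    proof
      fix B :: real assume B: "B \<in> {1<..}"
      have "H_ab (vector [1, \<sigma>, sqrt (B - 1)]) = 0" "H_b (vector [1, \<sigma>, sqrt (B - 1)]) = B"
        using B sg by (simp_all add: H_ab_def H_b_def)
      then show "B \<in> {B. poly c B = 0}"
        using Suc.prems[of "vector [1, \<sigma>, sqrt (B - 1)]"] by (simp add: C evK_pCons ss)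
    qed
    ultimately show False using infinite_Ioi finite_subset by blast
  qed
  have H: "H_ab p = (p$1 + \<sigma> * p$2) * (p$1 - \<sigma> * p$2)" for p
    using ss by (simp add: H_ab_def algebra_simps power2_eq_square)
  have "(p$1 - \<sigma> * p$2) * ((p$1 - \<sigma> * p$2) ^ N * g p - (p$1 + \<sigma> * p$2) ^ Suc M * evK D p) = 0" for p
    using Suc.prems[of p] by (simp add: C \<open>c = 0\<close> evK_pCons H algebra_simps)
  then have "(p$1 - \<sigma> * p$2) ^ N * g p - (p$1 + \<sigma> * p$2) ^ Suc M * evK D p = 0" for p
    by (rule real_polynomial_function_mult_eq_0[where u = "vector [1, 0, 0]", rotated 2])
      (use g in simp_all)
  then have "(p$1 - \<sigma> * p$2) ^ N * g p = (p$1 + \<sigma> * p$2) ^ Suc M * evK D p" for p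
    by (metis eq_iff_diff_eq_0)
  from Suc.IH[OF this] show ?case by simp
qed

section \<open>The top component and the equation in the next lower degree\<close>

lemma of_nat_mult_power_pred: "of_nat n * x ^ (n - 1) * x = of_nat n * (x::real) ^ n"
  by (cases n) auto

text \<open>With u = x + \<sigma> y and w = x - \<sigma> y, the factor w^N cancels the cofactor s z,
  so w^N g is a function of A and B, and g = u^N F follows by division. The same w^N, with one more
  A, turns the equation of the next degree into an exactness statement whose two coefficients yield
  the last two conclusions.\<close>

lemma top_component_normal_form:
  assumes g: "real_polynomial_function g" and h: "real_polynomial_function h" and nz: "g u \<noteq> 0"
    and eig: "\<And>v. L2 g v = (p * v$1 + q * v$2 + s * v$3) * g v"
    and next_eq: "\<And>v. L1 a b g v + L2 h v = k0 * g v + (p * v$1 + q * v$2 + s * v$3) * h v"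
  obtains \<sigma> N F where "\<sigma> = 1 \<or> \<sigma> = -1" "p = 0" "q = 0" "s = \<sigma> * real N"
    "\<And>v. g v = (v$1 + \<sigma> * v$2) ^ N * evK F v"
    "[:[:k0 - real N * b:]:] * F = [:[:2 * b:]:] * (VA * pderiv F) + [:[:2:]:] * (VB * map_poly pderiv F)"
    "[:[:2 * (a - b):]:] * (VA * pderiv F) + [:[:2 * (a - 1):]:] * (VA * map_poly pderiv F)
      + [:[:real N * (a - b):]:] * F = 0"
proof -
  obtain N :: nat where "p = 0" "q = 0" and N: "s = real N \<or> s = - real N"
    using L2_cofactor[OF g nz eig] by blast
  obtain \<sigma> :: real where \<sigma>: "\<sigma> = 1 \<or> \<sigma> = -1" and s: "s = \<sigma> * real N"
    using N by (metis mult_1 mult_minus1)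
  have ss: "\<sigma>\<^sup>2 = 1" "\<sigma> * \<sigma> = 1" "\<sigma> * (\<sigma> * x) = x" for x using \<sigma> by auto
  let ?w = "\<lambda>v::real^3. v$1 - \<sigma> * v$2"
  let ?u = "\<lambda>v::real^3. v$1 + \<sigma> * v$2"
  have L2w: "L2 (\<lambda>v. ?w v ^ N) v = - (\<sigma> * N * v$3) * ?w v ^ N" for v
  proof -
    have "L2 ?w v = - (\<sigma> * v$3) * ?w v"
      using ss by (simp add: algebra_simps)
    then have "L2 (\<lambda>v. ?w v ^ N) v = (of_nat N * ?w v ^ (N - 1) * ?w v) * (- (\<sigma> * v$3))"
      by simp
    then show ?thesis unfolding of_nat_mult_power_pred by simp
  qed
  have wg: "real_polynomial_function (\<lambda>v. ?w v ^ N * g v)" using g by simp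
  obtain C where C: "(\<lambda>v. ?w v ^ N * g v) = evK C"
  proof -
    have "L2 (\<lambda>v. ?w v ^ N * g v) v = 0" for v
    proof -
      have "L2 (\<lambda>v. ?w v ^ N * g v) v = ?w v ^ N * L2 g v + L2 (\<lambda>v. ?w v ^ N) v * g v"
        by (rule lie_mult) (use g in simp_all)
      then show ?thesis
        unfolding L2w eig using s \<open>p = 0\<close> \<open>q = 0\<close> by (simp add: algebra_simps)
    qed
    moreover obtain v where "?w v ^ N * g v \<noteq> 0"
      using real_polynomial_function_mult_eq_0[of "\<lambda>v. ?w v ^ N" g "vector [1, 0, 0]" u] g nz by fastforce
    ultimately show ?thesis
      using L2_eigen(2)[OF wg, of v 0 0 0] that by auto
  qed
  obtain F where F: "\<And>v. g v = ?u v ^ N * evK F v"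
    using divide_out_linear_factor[OF g ss(1), of N 0 C] fun_cong[OF C] by auto
  define \<alpha> where "\<alpha> = [:[:k0 - real N * b:]:] * F - ([:[:2 * b:]:] * (VA * pderiv F) + [:[:2:]:] * (VB * map_poly pderiv F))"
  define \<beta> where "\<beta> = [:[:2 * (a - b):]:] * (VA * pderiv F) + [:[:2 * (a - 1):]:] * (VA * map_poly pderiv F)
      + [:[:real N * (a - b):]:] * F"
  define r where "r = (\<lambda>v. ?w v ^ N * h v)"
  have r: "real_polynomial_function r" unfolding r_def using h by simp
  \<comment> \<open>The factor \<open>H_ab\<close> supplies the u missing in L1(u^N) = N u^(N-1) (a
    x + \<sigma> b y) and a w to multiply the linear form. The last term cancels the xy-part of w (a
    x + \<sigma> b y), since L2 z = -xy.\<close>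
  define G where "G = (\<lambda>v. H_ab v * r v - \<sigma> * (b - a) * N * (evK (VA ^ N * F) v * v$3))"
  have H: "H_ab v = ?u v * ?w v" for v
    using ss by (simp add: H_ab_def algebra_simps power2_eq_square)
  have "L2 G v = evK (VA ^ N * (VA * \<alpha>)) v + evK (VA ^ N * (- \<beta>)) v * (v$1)\<^sup>2" for v
  proof -
    define U W A Fv FA FB where "U = ?u v" "W = ?w v" "A = H_ab v" "Fv = evK F v"
      "FA = evK (pderiv F) v" "FB = evK (map_poly pderiv F) v"
    note d = this
    have A: "A = U * W" by (simp add: d H)
    have A2: "A = (v$1)\<^sup>2 - (v$2)\<^sup>2" by (simp add: d H_ab_def)
    have gv: "g v = U ^ N * Fv" by (simp add: F d)
    have gfun: "g = (\<lambda>v. ?u v ^ N * evK F v)" using F by blast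
    have "L1 a b g v = U ^ N * L1 a b (evK F) v + real N * U ^ (N - 1) * (a * v$1 + \<sigma> * b * v$2) * Fv"
      unfolding gfun by (simp add: d algebra_simps)
    then have "U * L1 a b g v = U * U ^ N * L1 a b (evK F) v + (real N * U ^ (N - 1) * U) * (a * v$1 + \<sigma> * b * v$2) * Fv"
      by (simp only:) (simp add: algebra_simps)
    then have "W ^ N * (W * (U * L1 a b g v)) = W ^ N * (W * (U * U ^ N * L1 a b (evK F) v + (real N * U ^ N) * (a * v$1 + \<sigma> * b * v$2) * Fv))"
      unfolding of_nat_mult_power_pred by simp
    then have L1g: "A * W ^ N * L1 a b g v = A ^ N * (A * L1 a b (evK F) v + real N * (W * (a * v$1 + \<sigma> * b * v$2)) * Fv)"
      unfolding A power_mult_distrib by (simp add: algebra_simps)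
    have "L2 (\<lambda>v. ?w v ^ N * h v) v = ?w v ^ N * L2 h v + L2 (\<lambda>v. ?w v ^ N) v * h v"
      by (rule lie_mult) (use h in simp_all)
    then have L2wh: "L2 (\<lambda>v. ?w v ^ N * h v) v = W ^ N * (L2 h v - \<sigma> * N * v$3 * h v)"
      unfolding L2w by (simp add: d algebra_simps)
    have "L2 h v - \<sigma> * N * v$3 * h v = k0 * g v - L1 a b g v"
      using next_eq[of v] s \<open>p = 0\<close> \<open>q = 0\<close> by (simp add: algebra_simps)
    note L2wh = L2wh[unfolded this]
    have "L2 G v = A * L2 r v + \<sigma> * (b - a) * N * (A ^ N * Fv * (v$1 * v$2))"
      unfolding G_def using r by (simp add: d)
    also have "A * L2 r v = A * W ^ N * (k0 * g v) - A * W ^ N * L1 a b g v"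
      unfolding r_def L2wh by (simp add: algebra_simps)
    also have "A * W ^ N * (k0 * g v) = k0 * (A ^ N * A * Fv)"
      unfolding gv A power_mult_distrib by (simp add: algebra_simps)
    also note L1g
    finally have L2G: "L2 G v = A ^ N * (k0 * A * Fv - A * L1 a b (evK F) v
        - N * Fv * (W * (a * v$1 + \<sigma> * b * v$2) - \<sigma> * (b - a) * (v$1 * v$2)))"
      by (simp add: algebra_simps)
    have "W * (a * v$1 + \<sigma> * b * v$2) - \<sigma> * (b - a) * (v$1 * v$2) = (a - b) * (v$1)\<^sup>2 + b * A"
      unfolding A2 using ss by (simp add: d power2_eq_square algebra_simps)
    note L2G = L2G[unfolded this]
    show ?thesis
      unfolding L2G L1_evK \<alpha>_def \<beta>_def by (simp add: d algebra_simps)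
  qed
  moreover have "real_polynomial_function G" unfolding G_def using r by simp
  ultimately have "VA ^ N * (VA * \<alpha>) = 0" "VA ^ N * (- \<beta>) = 0"
    using L2_not_exact[of G] by blast+
  then have "\<alpha> = 0" "\<beta> = 0" by (auto simp: VA_def)
  show ?thesis
  proof (rule that[OF \<sigma> \<open>p = 0\<close> \<open>q = 0\<close> s F])
    show "[:[:k0 - real N * b:]:] * F = [:[:2 * b:]:] * (VA * pderiv F) + [:[:2:]:] * (VB * map_poly pderiv F)"
      using \<open>\<alpha> = 0\<close> unfolding \<alpha>_def by (rule eq_iff_diff_eq_0[THEN iffD2])
  qed (use \<open>\<beta> = 0\<close> in \<open>simp add: \<beta>_def\<close>)
qed

text \<open>The first hypothesis is an eigenvalue equation for the weighted Euler operator 2 b A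
  d/dA + 2 B d/dB, so the monomials A^i B^j of F lie on one line. In the second, A d/dB lowers j and
  raises i, which gives a recursion between (i, j) and (i - 1, j + 1).\<close>

lemma coefficient_equations:
  fixes a b k0 N :: real and F :: ring_K
  assumes \<alpha>: "[:[:k0 - N * b:]:] * F = [:[:2 * b:]:] * (VA * pderiv F) + [:[:2:]:] * (VB * map_poly pderiv F)"
    and \<beta>: "[:[:2 * (a - b):]:] * (VA * pderiv F) + [:[:2 * (a - 1):]:] * (VA * map_poly pderiv F)
      + [:[:N * (a - b):]:] * F = 0"
  shows "coeff (coeff F i) j \<noteq> 0 \<Longrightarrow> k0 = N * b + 2 * b * real i + 2 * real j"
    and "(a - b) * (2 * real i + N) * coeff (coeff F i) j
      + (if i = 0 then 0 else 2 * (a - 1) * (real j + 1) * coeff (coeff F (i - 1)) (j + 1)) = 0"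
proof -
  have c1: "coeff (coeff ([:[:c:]:] * G) i) j = c * coeff (coeff G i) j" for c i j and G :: ring_K by simp
  have c2: "coeff (coeff (VA * G) i) j = (if i = 0 then 0 else coeff (coeff G (i - 1)) j)" for i j and G :: ring_K
    by (cases i) (auto simp: VA_def)
  have c3: "coeff (coeff (VB * G) i) j = (if j = 0 then 0 else coeff (coeff G i) (j - 1))" for i j and G :: ring_K
    by (cases j) (auto simp: VB_def)
  have dA: "coeff (coeff (pderiv F) i) j = (real i + 1) * coeff (coeff F (i + 1)) j" for i j
    by (simp add: coeff_pderiv of_nat_poly algebra_simps)
  have dB: "coeff (coeff (map_poly pderiv F) i) j = (real j + 1) * coeff (coeff F i) (j + 1)" for i j
    by (simp add: coeff_map_poly coeff_pderiv algebra_simps)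
  have "coeff (coeff ([:[:k0 - N * b:]:] * F) i) j =
    coeff (coeff ([:[:2 * b:]:] * (VA * pderiv F) + [:[:2:]:] * (VB * map_poly pderiv F)) i) j" using \<alpha> by simp
  then have "(k0 - N * b - 2 * b * real i - 2 * real j) * coeff (coeff F i) j = 0"
    unfolding coeff_add c1 c2 c3 dA dB by (cases i; cases j) (simp_all add: algebra_simps)
  then show "coeff (coeff F i) j \<noteq> 0 \<Longrightarrow> k0 = N * b + 2 * b * real i + 2 * real j" by simp
  have "coeff (coeff ([:[:2 * (a - b):]:] * (VA * pderiv F) + [:[:2 * (a - 1):]:] * (VA * map_poly pderiv F)
      + [:[:N * (a - b):]:] * F) i) j = 0" using \<beta> by simp
  then show "(a - b) * (2 * real i + N) * coeff (coeff F i) j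
      + (if i = 0 then 0 else 2 * (a - 1) * (real j + 1) * coeff (coeff F (i - 1)) (j + 1)) = 0"
    unfolding coeff_add c1 c2 dA dB by (cases i) (simp_all add: algebra_simps)
qed

lemma evK_expand:
  "evK F v = (\<Sum>i\<le>degree F. \<Sum>j\<le>degree (coeff F i). coeff (coeff F i) j * (H_ab v ^ i * H_b v ^ j))"
proof -
  have "poly (coeff F i) (H_b v) * H_ab v ^ i =
    (\<Sum>j\<le>degree (coeff F i). coeff (coeff F i) j * (H_ab v ^ i * H_b v ^ j))" for i
    by (simp add: poly_altdef[of "coeff F i"] sum_distrib_left mult.commute mult.left_commute)
  then show ?thesis
    by (simp add: evK_def poly_altdef[of F] poly_sum)
qed

section \<open>Generation\<close>

definition generated_with_cofactor ::
    "(real^3 \<Rightarrow> real^3) \<Rightarrow> (real^3 \<Rightarrow> real) set \<Rightarrow> (real^3 \<Rightarrow> real) \<Rightarrow> (real^3 \<Rightarrow> real) \<Rightarrow> bool" where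
  "generated_with_cofactor X I f k \<longleftrightarrow> has_cofactor X f k \<and> f \<in> generated X I"

lemma generated_with_cofactor_zero:
  "real_polynomial_function k \<Longrightarrow> generated_with_cofactor X I (\<lambda>p. 0) k"
  by (simp add: generated_with_cofactor_def has_cofactor_def generated.const)

lemma generated_with_cofactor_const: "generated_with_cofactor X I (\<lambda>p. c) (\<lambda>p. 0)"
  by (simp add: generated_with_cofactor_def has_cofactor_def generated.const)

lemma generated_with_cofactor_mult:
  assumes "generated_with_cofactor X I f k" "generated_with_cofactor X I g l"
  shows "generated_with_cofactor X I (\<lambda>p. f p * g p) (\<lambda>p. k p + l p)"
  using assms unfolding generated_with_cofactor_def has_cofactor_def
  by (auto simp: algebra_simps intro: generated.prod)

lemma generated_with_cofactor_cmult:
  assumes "generated_with_cofactor X I f k"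
  shows "generated_with_cofactor X I (\<lambda>p. c * f p) k"
  using generated_with_cofactor_mult[OF generated_with_cofactor_const assms] by simp

lemma generated_with_cofactor_power:
  assumes "generated_with_cofactor X I f k"
  shows "generated_with_cofactor X I (\<lambda>p. f p ^ n) (\<lambda>p. real n * k p)"
proof (induction n)
  case 0
  then show ?case using generated_with_cofactor_const[of X I 1] by simp
next
  case (Suc n)
  from generated_with_cofactor_mult[OF assms Suc] show ?case by (simp add: algebra_simps)
qed

lemma generated_with_cofactor_add:
  assumes "generated_with_cofactor X I f k" "generated_with_cofactor X I g k"
  shows "generated_with_cofactor X I (\<lambda>p. f p + g p) k"
proof -
  have "has_cofactor X (\<lambda>p. f p + g p) k"
    using assms unfolding generated_with_cofactor_def has_cofactor_def by (auto simp: algebra_simps)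
  then show ?thesis
    using assms generated.sum unfolding generated_with_cofactor_def by blast
qed

lemma generated_with_cofactor_sum:
  assumes "finite S" "\<And>i. i \<in> S \<Longrightarrow> generated_with_cofactor X I (f i) k" "real_polynomial_function k"
  shows "generated_with_cofactor X I (\<lambda>p. \<Sum>i\<in>S. f i p) k"
  using assms
  by (induction S rule: finite_induct)
    (auto intro: generated_with_cofactor_zero generated_with_cofactor_add)

section \<open>The listed polynomials and the linear factors as generators\<close>

lemma lie_X_field:
  "real_polynomial_function f \<Longrightarrow> lie_derivative (X_field a b) f p = L1 a b f p + L2 f p"
  unfolding X_field_decomp by (rule lie_add_field)

lemma has_cofactor_H_b: "a = 1 \<Longrightarrow> has_cofactor (X_field a b) H_b (\<lambda>p. 2)"
  unfolding has_cofactor_def H_b_def[abs_def]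
  by (simp add: X_field_def algebra_simps power2_eq_square)

lemma has_cofactor_H_a: "b = 1 \<Longrightarrow> has_cofactor (X_field a b) H_a (\<lambda>p. 2)"
  unfolding has_cofactor_def H_a_def[abs_def]
  by (simp add: X_field_def algebra_simps power2_eq_square)

lemma has_cofactor_H_ab: "a = b \<Longrightarrow> has_cofactor (X_field a b) H_ab (\<lambda>p. 2 * a)"
  unfolding has_cofactor_def H_ab_def[abs_def]
  by (simp add: X_field_def algebra_simps power2_eq_square)

lemma has_cofactor_H_ab_plus: "has_cofactor (X_field a a) H_ab_plus (\<lambda>p. a + p$3)"
  unfolding has_cofactor_def H_ab_plus_def[abs_def]
  by (simp add: X_field_def algebra_simps power2_eq_square)

definition generators :: "real \<Rightarrow> real \<Rightarrow> (real^3 \<Rightarrow> real) set" where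
  "generators a b = (if a = b then listed a b \<union> {H_ab_minus, H_ab_plus} else listed a b)"

lemma generators_with_cofactor:
  "a = 1 \<Longrightarrow> generated_with_cofactor (X_field a b) (generators a b) H_b (\<lambda>p. 2)"
  "b = 1 \<Longrightarrow> generated_with_cofactor (X_field a b) (generators a b) H_a (\<lambda>p. 2)"
  "a = b \<Longrightarrow> generated_with_cofactor (X_field a b) (generators a b) H_ab (\<lambda>p. 2 * a)"
  "a = b \<Longrightarrow> \<sigma> = 1 \<or> \<sigma> = -1 \<Longrightarrow>
    generated_with_cofactor (X_field a b) (generators a b) (\<lambda>p. p$1 + \<sigma> * p$2) (\<lambda>p. a + \<sigma> * p$3)"
proof -
  show "generated_with_cofactor (X_field a b) (generators a b) (\<lambda>p. p$1 + \<sigma> * p$2) (\<lambda>p. a + \<sigma> * p$3)"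
    if "a = b" "\<sigma> = 1 \<or> \<sigma> = -1"
    using that(2)
  proof
    assume "\<sigma> = 1"
    then show ?thesis
      using that(1) has_cofactor_H_ab_plus[of a]
      by (auto simp: generated_with_cofactor_def generators_def H_ab_plus_def[abs_def] intro!: generated.base)
  next
    assume "\<sigma> = -1"
    then show ?thesis
      using that(1) has_cofactor_H_ab_minus[of a]
      by (auto simp: generated_with_cofactor_def generators_def H_ab_minus_def[abs_def] intro!: generated.base)
  qed
qed (auto simp: generated_with_cofactor_def generators_def listed_def
    has_cofactor_H_b has_cofactor_H_a has_cofactor_H_ab[of b b, simplified] intro: generated.base)

text \<open>By hypothesis dF/dA + dF/dB = 0, so F is constant along (A + t, B + t); taking t = -A
  leads to (0, B - A). Since B - A = y^2 + z^2, this is how \<open>H_a\<close> arises.\<close>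

lemma poly_constant_along_diagonal:
  assumes "pderiv F + map_poly pderiv F = (0::ring_K)"
  shows "poly (poly F [:A:]) B = poly (coeff F 0) (B - A)"
proof -
  have D: "((\<lambda>t. poly (poly F [:A + t:]) (B + t)) has_real_derivative
    poly (poly (pderiv F + map_poly pderiv F) [:A + t:]) (B + t)) (at t)" for t F
  proof (induction F)
    case (pCons c F)
    have "((\<lambda>t. poly c (B + t)) has_real_derivative poly (pderiv c) (B + t)) (at t)"
      by (rule DERIV_chain2[OF poly_DERIV, THEN DERIV_cong]) (auto intro!: derivative_eq_intros)
    moreover have "((\<lambda>t. A + t) has_real_derivative 1) (at t)"
      by (auto intro!: derivative_eq_intros)
    ultimately have "((\<lambda>t. poly c (B + t) + (A + t) * poly (poly F [:A + t:]) (B + t)) has_real_derivative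
      poly (pderiv c) (B + t) + (1 * poly (poly F [:A + t:]) (B + t)
        + poly (poly (pderiv F + map_poly pderiv F) [:A + t:]) (B + t) * (A + t))) (at t)"
      using pCons(2) by (intro DERIV_add DERIV_mult)
    moreover have "(\<lambda>t. poly (poly (pCons c F) [:A + t:]) (B + t)) =
      (\<lambda>t. poly c (B + t) + (A + t) * poly (poly F [:A + t:]) (B + t))" by simp
    ultimately show ?case
      by (simp only:) (erule DERIV_cong, simp add: pderiv_pCons map_poly_pCons algebra_simps)
  qed simp
  have "((\<lambda>t. poly (poly F [:A + t:]) (B + t)) has_real_derivative 0) (at t)" for t
    using D[of F t] unfolding assms by simp
  then have "\<forall>t. DERIV (\<lambda>t. poly (poly F [:A + t:]) (B + t)) t :> 0" by blast
  from DERIV_isconst_all[OF this, of 0 "- A"]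
  show ?thesis by (simp add: poly_0_coeff_0)
qed

text \<open>For a = b the second condition reduces to (a - 1) dF/dB = 0, so B occurs only if a = 1.
  For b = 1 \<noteq> a it makes F a function of B - A. For a \<noteq> b and b \<noteq> 1 no power of
  A survives, and B occurs only if a = 1.\<close>

lemma top_component_generated:
  fixes a b k0 \<sigma> :: real and F :: ring_K and N :: nat
  assumes nz: "F \<noteq> 0" and \<sigma>: "\<sigma> = 1 \<or> \<sigma> = -1"
    and \<alpha>: "[:[:k0 - real N * b:]:] * F = [:[:2 * b:]:] * (VA * pderiv F) + [:[:2:]:] * (VB * map_poly pderiv F)"
    and \<beta>: "[:[:2 * (a - b):]:] * (VA * pderiv F) + [:[:2 * (a - 1):]:] * (VA * map_poly pderiv F)
      + [:[:real N * (a - b):]:] * F = 0"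
  shows "generated_with_cofactor (X_field a b) (generators a b)
    (\<lambda>v. (v$1 + \<sigma> * v$2) ^ N * evK F v) (\<lambda>v. k0 + \<sigma> * real N * v$3)"
proof -
  let ?good = "generated_with_cofactor (X_field a b) (generators a b)"
  let ?k = "\<lambda>v::real^3. k0 + \<sigma> * real N * v$3"
  define c where "c i j = coeff (coeff F i) j" for i j
  have ca: "k0 = N * b + 2 * b * real i + 2 * real j" if "c i j \<noteq> 0" for i j
    using coefficient_equations(1)[OF \<alpha> \<beta>] that unfolding c_def by blast
  have cb0: "(a - b) * N * c 0 j = 0" for j
    using coefficient_equations(2)[OF \<alpha> \<beta>, of 0 j] unfolding c_def by simp
  have cb: "(a - b) * (2 * (real i + 1) + N) * c (Suc i) j + 2 * (a - 1) * (real j + 1) * c i (Suc j) = 0" for i j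
    using coefficient_equations(2)[OF \<alpha> \<beta>, of "Suc i" j] unfolding c_def by (simp add: algebra_simps)
  have c_nz: "\<exists>i j. c i j \<noteq> 0" using nz unfolding c_def by (metis coeff_0 poly_eqI)
  \<comment> \<open>Otherwise the recursion starts from a zero row i = 0, and its factor 2 (i + 1) +
    N never vanishes, so every row is zero.\<close>
  have "N = 0 \<or> a = b"
  proof (rule ccontr)
    assume neg: "\<not> ?thesis"
    have "\<forall>j. c i j = 0" for i
    proof (induction i)
      case 0
      then show ?case using cb0 neg by simp
    next
      case (Suc i)
      have "2 * (real i + 1) + N > 0" by simp
      then show ?case using cb[of i] Suc neg by simp
    qed
    then show False using c_nz by blast
  qed
  have rk: "real_polynomial_function ?k" by simp
  \<comment> \<open>Reduction to the monomials that occur in F; the others enter the sum as the zero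
    function, which has every cofactor.\<close>
  have expand: "?good (\<lambda>v. (v$1 + \<sigma> * v$2) ^ N * evK F v) ?k"
    if "\<And>i j. c i j \<noteq> 0 \<Longrightarrow> ?good (\<lambda>v. (v$1 + \<sigma> * v$2) ^ N * (H_ab v ^ i * H_b v ^ j)) ?k"
  proof -
    have "?good (\<lambda>v. c i j * ((v$1 + \<sigma> * v$2) ^ N * (H_ab v ^ i * H_b v ^ j))) ?k" for i j
      using that[of i j] generated_with_cofactor_cmult generated_with_cofactor_zero[OF rk]
      by (cases "c i j = 0") (simp, blast)
    then have "?good (\<lambda>v. \<Sum>i\<le>degree F. \<Sum>j\<le>degree (coeff F i).
        c i j * ((v$1 + \<sigma> * v$2) ^ N * (H_ab v ^ i * H_b v ^ j))) ?k"
      by (intro generated_with_cofactor_sum rk) auto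
    then show ?thesis
      by (simp add: evK_expand c_def sum_distrib_left mult.left_commute)
  qed
  show ?thesis
  proof (cases "a = b")
    case True
    show ?thesis
    proof (rule expand)
      fix i j assume nz: "c i j \<noteq> 0"
      have "j = 0 \<or> a = 1" using cb[of i "j - 1"] nz True by (cases j) auto
      then have B: "?good (\<lambda>v. H_b v ^ j) (\<lambda>v. real j * 2)"
        using generated_with_cofactor_power[OF generators_with_cofactor(1), of a b j]
          generated_with_cofactor_const[of _ _ 1] by auto
      have A: "?good (\<lambda>v. H_ab v ^ i) (\<lambda>v. real i * (2 * a))"
        by (rule generated_with_cofactor_power[OF generators_with_cofactor(3)[OF True]])
      have u: "?good (\<lambda>v. (v$1 + \<sigma> * v$2) ^ N) (\<lambda>v. real N * (a + \<sigma> * v$3))"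
        by (rule generated_with_cofactor_power[OF generators_with_cofactor(4)[OF True \<sigma>]])
      have "(\<lambda>v. real N * (a + \<sigma> * v$3) + (real i * (2 * a) + real j * 2)) = ?k"
        using ca[OF nz] True by (auto simp: algebra_simps)
      with generated_with_cofactor_mult[OF u generated_with_cofactor_mult[OF A B]]
      show "?good (\<lambda>v. (v$1 + \<sigma> * v$2) ^ N * (H_ab v ^ i * H_b v ^ j)) ?k" by simp
    qed
  next
    case False
    then have N: "N = 0" using \<open>N = 0 \<or> a = b\<close> by simp
    show ?thesis
    proof (cases "b = 1")
      case True
      \<comment> \<open>With N = 0 and b = 1 both coefficients of the second condition equal 2 (a -
        1), which is nonzero as a \<noteq> b.\<close>
      have "[:[:2 * (a - 1):]:] * (VA * (pderiv F + map_poly pderiv F)) = 0"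
        using \<beta> N True by (simp add: algebra_simps smult_add_right)
      moreover have "[:[:2 * (a - 1):]:] \<noteq> (0::ring_K)" "VA \<noteq> 0"
        using False True by (auto simp: VA_def)
      ultimately have "pderiv F + map_poly pderiv F = 0"
        by (metis mult_eq_0_iff)
      then have "evK F v = poly (coeff F 0) (H_b v - H_ab v)" for v
        unfolding evK_def by (rule poly_constant_along_diagonal)
      moreover have "H_b v - H_ab v = H_a v" for v
        by (simp add: H_b_def H_ab_def H_a_def)
      ultimately have e: "evK F v = (\<Sum>j\<le>degree (coeff F 0). c 0 j * H_a v ^ j)" for v
        by (simp add: poly_altdef c_def)
      have "?good (\<lambda>v. c 0 j * H_a v ^ j) (\<lambda>v. k0)" for j
      proof (cases "c 0 j = 0")
        case True
        then show ?thesis by (simp add: generated_with_cofactor_zero)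
      next
        case nz: False
        have "?good (\<lambda>v. H_a v ^ j) (\<lambda>v. real j * 2)"
          by (rule generated_with_cofactor_power[OF generators_with_cofactor(2)[OF True]])
        then show ?thesis
          using ca[OF nz] N generated_with_cofactor_cmult by (auto simp: mult.commute)
      qed
      then have "?good (\<lambda>v. \<Sum>j\<le>degree (coeff F 0). c 0 j * H_a v ^ j) (\<lambda>v. k0)"
        by (intro generated_with_cofactor_sum) auto
      then show ?thesis using N by (simp add: e)
    next
      case b: False
      show ?thesis
      proof (rule expand)
        fix i j assume nz: "c i j \<noteq> 0"
        \<comment> \<open>A monomial (i + 1, j) would require its neighbour (i, j + 1), and their
          equal weights would give 2 b = 2.\<close>
        have z: "c (Suc i) j = 0" if "a \<noteq> 1" for i j
        proof (rule ccontr)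
          assume n: "c (Suc i) j \<noteq> 0"
          have "2 * (real i + 1) > 0" by simp
          then have n': "c i (Suc j) \<noteq> 0" using cb[of i j] n N False by auto
          have "b = 1" using ca[OF n] ca[OF n'] by (simp add: algebra_simps)
          then show False using b by simp
        qed
        have "i = 0"
        proof (cases "a = 1")
          case True
          show ?thesis
          proof (rule ccontr)
            assume "i \<noteq> 0"
            then obtain i' where i': "i = Suc i'" by (cases i) auto
            have "2 * (real i' + 1) > 0" by simp
            then show False using cb[of i' j] nz True False N unfolding i' by auto
          qed
        next
          case False
          then show ?thesis using z nz by (cases i) auto
        qed
        moreover have "j = 0 \<or> a = 1"
        proof (rule ccontr)
          assume neg: "\<not> ?thesis"
          then obtain j' where j': "j = Suc j'" by (cases j) auto
          have "real j' + 1 > 0" by simp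
          then show False using cb[of 0 j'] z[of 0 j'] nz neg \<open>i = 0\<close> unfolding j' by auto
        qed
        then have "?good (\<lambda>v. H_b v ^ j) (\<lambda>v. real j * 2)"
          using generated_with_cofactor_power[OF generators_with_cofactor(1), of a b j]
            generated_with_cofactor_const[of _ _ 1] by auto
        ultimately show "?good (\<lambda>v. (v$1 + \<sigma> * v$2) ^ N * (H_ab v ^ i * H_b v ^ j)) ?k"
          using ca[OF nz] N by (simp add: mult.commute)
      qed
    qed
  qed
qed

section \<open>The Darboux equation degree by degree\<close>

lemma hom_poly_L1: "hom_poly n f \<Longrightarrow> hom_poly n (L1 a b f)"
proof (induction rule: hom_poly.induct)
  case (nth i)
  have eq: "L1 a b (\<lambda>p. p$i) = (\<lambda>p. (if i = 1 then a else if i = 2 then b else 1) * p$i)"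
    by (rule ext) (use exhaust_3[of i] in auto)
  show ?case unfolding eq by (rule hom_poly_cmult[OF hom_poly.nth])
next
  case (add n f g)
  have eq: "L1 a b (\<lambda>p. f p + g p) = (\<lambda>p. L1 a b f p + L1 a b g p)"
    using add.hyps hom_poly_imp_polynomial by (intro ext lie_add) auto
  show ?case unfolding eq by (rule hom_poly.add[OF add.IH])
next
  case (mult m f n g)
  have eq: "L1 a b (\<lambda>p. f p * g p) = (\<lambda>p. f p * L1 a b g p + L1 a b f p * g p)"
    using mult.hyps hom_poly_imp_polynomial by (intro ext lie_mult) auto
  show ?case unfolding eq
    by (intro hom_poly.add hom_poly.mult mult.IH mult.hyps)
qed (use hom_poly.zero hom_poly.const in \<open>auto simp: lie_const[abs_def]\<close>)

lemma hom_poly_L2: "hom_poly n f \<Longrightarrow> hom_poly (Suc n) (L2 f)"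
proof (induction rule: hom_poly.induct)
  case (nth i)
  have hom: "hom_poly (1 + 1) (\<lambda>p. p$2 * p$3)" "hom_poly (1 + 1) (\<lambda>p. p$1 * p$3)" "hom_poly (1 + 1) (\<lambda>p. - 1 * (p$1 * p$2))"
    by (intro hom_poly.mult hom_poly.nth hom_poly_cmult)+
  have L2: "L2 (\<lambda>p. p$1) = (\<lambda>p. p$2 * p$3)" "L2 (\<lambda>p. p$2) = (\<lambda>p. p$1 * p$3)"
    "L2 (\<lambda>p. p$3) = (\<lambda>p. - 1 * (p$1 * p$2))"
    by (rule ext; simp)+
  consider "i = 1" | "i = 2" | "i = 3" using exhaust_3 by blast
  then show ?case by cases (use hom in \<open>simp_all only: L2 Suc_eq_plus1\<close>)
next
  case (add n f g)
  have eq: "L2 (\<lambda>p. f p + g p) = (\<lambda>p. L2 f p + L2 g p)"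
    using add.hyps hom_poly_imp_polynomial by (intro ext lie_add) auto
  show ?case unfolding eq by (rule hom_poly.add[OF add.IH])
next
  case (mult m f n g)
  have eq: "L2 (\<lambda>p. f p * g p) = (\<lambda>p. f p * L2 g p + L2 f p * g p)"
    using mult.hyps hom_poly_imp_polynomial by (intro ext lie_mult) auto
  have "hom_poly (m + Suc n) (\<lambda>p. f p * L2 g p)" "hom_poly (Suc m + n) (\<lambda>p. L2 f p * g p)"
    by (intro hom_poly.mult mult.IH mult.hyps)+
  then show ?case unfolding eq by (intro hom_poly.add) simp_all
qed (use hom_poly.zero in \<open>auto simp: lie_const[abs_def]\<close>)

lemma homogeneous_cofactor_equations:
  assumes g: "\<And>i. hom_poly i (g i)" "\<And>i p. i \<ge> n \<Longrightarrow> g i p = 0"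
    and k: "\<And>i. hom_poly i (k i)" "\<And>i p. i \<ge> m \<Longrightarrow> k i p = 0"
    and eq: "\<And>p. lie_derivative (X_field a b) (\<lambda>p. \<Sum>i<n. g i p) p = (\<Sum>i<m. k i p) * (\<Sum>i<n. g i p)"
  shows "L1 a b (g i) p + (if i = 0 then 0 else L2 (g (i - 1)) p) = (\<Sum>j\<le>i. k j p * g (i - j) p)"
proof -
  \<comment> \<open>Larger than i and than every degree occurring on either side.\<close>
  define T where "T = Suc (i + n + m)"
  \<comment> \<open>The part of degree i of the difference of both sides; L2 contributes from degree
    i - 1. The factor -1 replaces a subtraction, as \<open>hom_poly\<close> is closed under sums and
    multiples.\<close>
  define h where "h i p = L1 a b (g i) p + (if i = 0 then 0 else L2 (g (i - 1)) p) +
    (- 1) * (\<Sum>j\<le>i. k j p * g (i - j) p)" for i p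
  have rg: "real_polynomial_function (g i)" for i using g(1) hom_poly_imp_polynomial by blast
  have g0: "g i = (\<lambda>p. 0)" if "i \<ge> n" for i using g(2) that by blast
  have "hom_poly i (h i)" for i
  proof -
    have "hom_poly i (\<lambda>p. if i = 0 then 0 else L2 (g (i - 1)) p)"
      using hom_poly_L2[OF g(1), of "i - 1"] by (cases i) (auto intro: hom_poly.const)
    moreover have "hom_poly i (\<lambda>p. k j p * g (i - j) p)" if "j \<le> i" for j
      using hom_poly.mult[OF k(1)[of j] g(1)[of "i - j"]] that by simp
    ultimately show ?thesis
      unfolding h_def by (intro hom_poly.add hom_poly_L1 g hom_poly_cmult hom_poly_sum) auto
  qed
  moreover have "(\<Sum>i<T. h i p) = 0" for p
  proof -
    have "(\<Sum>i<T. L1 a b (g i) p) = (\<Sum>i<n. L1 a b (g i) p)"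
      by (rule sum.mono_neutral_right) (auto simp: T_def g0)
    moreover have "(\<Sum>i<T. if i = 0 then 0 else L2 (g (i - 1)) p) = (\<Sum>i<n. L2 (g i) p)"
    proof -
      have "(\<Sum>i<T. if i = 0 then 0 else L2 (g (i - 1)) p) = (\<Sum>i<i + n + m. L2 (g i) p)"
        unfolding T_def by (subst sum.lessThan_Suc_shift) simp
      also have "\<dots> = (\<Sum>i<n. L2 (g i) p)"
        by (rule sum.mono_neutral_right) (auto simp: g0)
      finally show ?thesis .
    qed
    moreover have "(\<Sum>i<T. \<Sum>j\<le>i. k j p * g (i - j) p) = (\<Sum>i<m. k i p) * (\<Sum>i<n. g i p)"
      by (rule sum_cauchy_product[symmetric]) (use g k in \<open>auto simp: T_def\<close>)
    moreover have "(\<Sum>i<m. k i p) * (\<Sum>i<n. g i p) = (\<Sum>i<n. L1 a b (g i) p) + (\<Sum>i<n. L2 (g i) p)"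
      unfolding eq[symmetric] using rg
      by (subst lie_sum) (auto simp: lie_X_field sum.distrib)
    ultimately show ?thesis
      unfolding h_def sum.distrib sum_distrib_left[symmetric] by simp
  qed
  ultimately have "h i p = 0" by (rule hom_sum_eq_0) (simp add: T_def)
  then show ?thesis by (simp add: h_def)
qed

lemma has_cofactor_diff:
  assumes "has_cofactor X f k" "has_cofactor X g k"
  shows "has_cofactor X (\<lambda>p. f p - g p) k"
  using assms unfolding has_cofactor_def by (auto simp: algebra_simps)

text \<open>Induction on the number of components with fixed cofactor \<open>K\<close>: the top
  component has cofactor \<open>K\<close> itself, hence so has the rest, and adding them back is an
  admissible sum.\<close>

lemma Dar_generated:
  assumes g: "\<And>i. hom_poly i (g i)" "\<And>i p. i \<ge> n \<Longrightarrow> g i p = 0"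
    and cof: "has_cofactor (X_field a b) (\<lambda>p. \<Sum>i<n. g i p) K"
  shows "(\<lambda>p. \<Sum>i<n. g i p) \<in> generated (X_field a b) (generators a b)"
  using assms
proof (induction n arbitrary: g)
  case 0
  then show ?case by (simp add: generated.const)
next
  case (Suc n)
  note g = Suc.prems(1,2)
  let ?G = "g n"
  have rg: "real_polynomial_function (g i)" for i using g(1) hom_poly_imp_polynomial by blast
  show ?case
  proof (cases "\<forall>p. ?G p = 0")
    case True
    have "g i p = 0" if "i \<ge> n" for i p
      using that True g(2) by (cases "i = n") auto
    moreover have "has_cofactor (X_field a b) (\<lambda>p. \<Sum>i<n. g i p) K"
      using Suc.prems(3) True by simp
    ultimately have "(\<lambda>p. \<Sum>i<n. g i p) \<in> generated (X_field a b) (generators a b)"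
      by (intro Suc.IH g(1))
    then show ?thesis using True by simp
  next
    case False
    then obtain u where u: "?G u \<noteq> 0" by blast
    have rK: "real_polynomial_function K" using Suc.prems(3) by (simp add: has_cofactor_def)
    obtain k m where k: "\<And>i. hom_poly i (k i)" "\<And>i. i \<ge> m \<Longrightarrow> k i = (\<lambda>p. 0)" and K: "K = (\<lambda>p. \<Sum>i<m. k i p)"
      using hom_decomposition[OF rK] by blast
    have rk: "real_polynomial_function (k i)" for i using k(1) hom_poly_imp_polynomial by blast
    have eqs: "L1 a b (g i) p + (if i = 0 then 0 else L2 (g (i - 1)) p) = (\<Sum>j\<le>i. k j p * g (i - j) p)" for i p
      by (rule homogeneous_cofactor_equations[where n = "Suc n" and m = m])
        (use g k Suc.prems(3) in \<open>auto simp: has_cofactor_def K\<close>)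
    have g0: "g i = (\<lambda>p. 0)" if "i > n" for i using g(2) that by (simp add: Suc_le_eq fun_eq_iff)
    \<comment> \<open>A cofactor has degree at most 1. Descending from \<open>m\<close>, degree n +
      j of the equation reads 0 = k_j g_n: the left side vanishes because n + j - 1 > n, and g_n is
      not zero.\<close>
    have k0: "k j p = 0" if "j \<ge> 2" for j p
      using that
    proof (induction "m - j" arbitrary: j p rule: less_induct)
      case less
      show ?case
      proof (cases "j \<ge> m")
        case True
        then show ?thesis using k(2) by simp
      next
        case False
        have k_above: "k i p = 0" if "i > j" for i p
          by (rule less.hyps) (use that False less.prems in auto)
        have "?G v * k j v = 0" for v
        proof -
          have "(\<Sum>i\<le>n + j. k i v * g (n + j - i) v) = (\<Sum>i\<in>{j}. k i v * g (n + j - i) v)"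
          proof (rule sum.mono_neutral_right)
            show "\<forall>i\<in>{..n + j} - {j}. k i v * g (n + j - i) v = 0"
            proof
              fix i assume "i \<in> {..n + j} - {j}"
              then have "i > j \<or> n + j - i > n" by auto
              then show "k i v * g (n + j - i) v = 0" using k_above g0 by auto
            qed
          qed auto
          moreover have "L1 a b (g (n + j)) v + (if n + j = 0 then 0 else L2 (g (n + j - 1)) v) = 0"
            using less.prems g0[of "n + j"] g0[of "n + j - 1"] by simp
          ultimately show ?thesis using eqs[of "n + j" v] by auto
        qed
        from real_polynomial_function_mult_eq_0[OF rg rk this u] show ?thesis .
      qed
    qed
    obtain \<kappa> where \<kappa>: "k 0 = (\<lambda>p. \<kappa>)" using hom_poly_0_1[OF k(1)] by blast
    obtain p q s where lin: "k 1 = (\<lambda>v. p * v$1 + q * v$2 + s * v$3)" using hom_poly_0_1[OF k(1)] by blast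
    have Kv: "K v = \<kappa> + (p * v$1 + q * v$2 + s * v$3)" for v
    proof -
      have "(\<Sum>i<m. k i v) = (\<Sum>i<m + 2. k i v)"
        by (rule sum.mono_neutral_left) (auto simp: k(2))
      also have "\<dots> = (\<Sum>i\<in>{0, 1}. k i v)"
        by (rule sum.mono_neutral_right) (auto simp: k0)
      finally show ?thesis by (simp add: K \<kappa> lin[unfolded One_nat_def])
    qed
    have sum01: "(\<Sum>j\<le>i. k j v * g (i - j) v) = \<kappa> * g i v + (if i = 0 then 0 else k 1 v * g (i - 1) v)" for i v
    proof (cases i)
      case (Suc i')
      have "(\<Sum>j\<le>i. k j v * g (i - j) v) = (\<Sum>j\<in>{0, 1}. k j v * g (i - j) v)"
        by (rule sum.mono_neutral_right) (auto simp: k0 Suc)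
      then show ?thesis by (simp add: \<kappa> Suc)
    qed (simp add: \<kappa>)
    \<comment> \<open>The component below the top one, taken as zero when n = 0.\<close>
    define h where "h = (if n = 0 then (\<lambda>v. 0) else g (n - 1))"
    have rh: "real_polynomial_function h" unfolding h_def using rg by simp
    \<comment> \<open>Degrees n + 1 and n of the equation are the two conditions on the top
      component.\<close>
    have eig: "L2 ?G v = (p * v$1 + q * v$2 + s * v$3) * ?G v" for v
      using eqs[of "Suc n" v] g0[of "Suc n"] unfolding sum01 lin by simp
    have next_eq: "L1 a b ?G v + L2 h v = \<kappa> * ?G v + (p * v$1 + q * v$2 + s * v$3) * h v" for v
      using eqs[of n v] unfolding sum01 lin h_def by (cases n) simp_all
    have good: "generated_with_cofactor (X_field a b) (generators a b) ?G K"
    proof (rule top_component_normal_form[OF rg rh u eig next_eq])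
      fix \<sigma> N F
      assume \<sigma>: "\<sigma> = 1 \<or> \<sigma> = -1" and z: "p = 0" "q = 0" "s = \<sigma> * real N"
        and G: "\<And>v. ?G v = (v$1 + \<sigma> * v$2) ^ N * evK F v"
        and e: "[:[:\<kappa> - real N * b:]:] * F = [:[:2 * b:]:] * (VA * pderiv F) + [:[:2:]:] * (VB * map_poly pderiv F)"
          "[:[:2 * (a - b):]:] * (VA * pderiv F) + [:[:2 * (a - 1):]:] * (VA * map_poly pderiv F)
            + [:[:real N * (a - b):]:] * F = 0"
      have "F \<noteq> 0" using G[of u] u by auto
      from top_component_generated[OF this \<sigma> e]
      have "generated_with_cofactor (X_field a b) (generators a b)
        (\<lambda>v. (v$1 + \<sigma> * v$2) ^ N * evK F v) (\<lambda>v. \<kappa> + \<sigma> * real N * v$3)" .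
      moreover have "(\<lambda>v. (v$1 + \<sigma> * v$2) ^ N * evK F v) = ?G" using G by auto
      moreover have "(\<lambda>v. \<kappa> + \<sigma> * real N * v$3) = K" using Kv z by auto
      ultimately show ?thesis by simp
    qed
    \<comment> \<open>The induction hypothesis asks for components that vanish from index n on, so
      the subtracted one is overwritten.\<close>
    let ?g = "g(n := \<lambda>p. 0)"
    have "(\<Sum>i<Suc n. g i v) - ?G v = (\<Sum>i<n. ?g i v)" for v by simp
    then have rest: "has_cofactor (X_field a b) (\<lambda>v. \<Sum>i<n. ?g i v) K"
      using has_cofactor_diff[OF Suc.prems(3), of ?G] good by (simp add: generated_with_cofactor_def)
    have "(\<lambda>v. \<Sum>i<n. ?g i v) \<in> generated (X_field a b) (generators a b)"
      by (rule Suc.IH[OF _ _ rest]) (use g in \<open>auto intro: hom_poly.zero\<close>)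
    with good rest have "generated_with_cofactor (X_field a b) (generators a b) (\<lambda>v. (\<Sum>i<n. ?g i v) + ?G v) K"
      by (intro generated_with_cofactor_add) (simp_all add: generated_with_cofactor_def)
    then show ?thesis by (simp add: generated_with_cofactor_def)
  qed
qed

lemma generators_generate_Dar: "generates_Dar (X_field a b) (generators a b)"
  unfolding generates_Dar_def
proof (intro conjI)
  have "generators a b \<subseteq> {H_b, H_a, H_ab, H_ab_minus, H_ab_plus}"
    by (auto simp: generators_def listed_def)
  then show "finite (generators a b)" by (rule finite_subset) simp
  show "generators a b \<subseteq> Dar (X_field a b)"
    using has_cofactor_H_b has_cofactor_H_a has_cofactor_H_ab has_cofactor_H_ab_plus has_cofactor_H_ab_minus
    by (fastforce simp: generators_def listed_def Dar_def split: if_splits)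
  show "Dar (X_field a b) \<subseteq> generated (X_field a b) (generators a b)"
  proof
    fix f assume "f \<in> Dar (X_field a b)"
    then obtain k where k: "has_cofactor (X_field a b) f k" by (auto simp: Dar_def)
    then have "real_polynomial_function f" by (simp add: has_cofactor_def)
    from hom_decomposition[OF this] obtain g n where g: "\<forall>i. hom_poly i (g i)"
      "\<forall>i\<ge>n. g i = (\<lambda>p. 0)" "f = (\<lambda>p. \<Sum>i<n. g i p)" by blast
    show "f \<in> generated (X_field a b) (generators a b)"
      unfolding g(3) by (rule Dar_generated) (use g k in auto)
  qed
qed

theorem mainTheorem1:
  fixes a b :: real
  shows "(a = 1 \<longrightarrow> has_cofactor (X_field a b) H_b (\<lambda>p. 2)) \<and>
         (b = 1 \<longrightarrow> has_cofactor (X_field a b) H_a (\<lambda>p. 2)) \<and>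
         (a = b \<longrightarrow> has_cofactor (X_field a b) H_ab (\<lambda>p. 2 * a)) \<and>
         (a \<noteq> b \<longrightarrow> generates_Dar (X_field a b) (listed a b)) \<and>
         (a = b \<longrightarrow> generates_Dar (X_field a b) (listed a b \<union> {H_ab_minus, H_ab_plus}))"
  using has_cofactor_H_b has_cofactor_H_a has_cofactor_H_ab generators_generate_Dar[of a b]
  by (auto simp: generators_def)

end
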